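(* Let $X_\star$ be a rank-$r_\star$ solution of the semidefinite program of minimizing $\langle C,X\rangle$ subject to $\mathcal{A}(X)=b$, $X\succeq0$, let $r\ge r_\star$ and let $U_\star\in\mathbb{R}^{n\times r}$ with $X_\star=U_\star U_\star^\top$. Suppose the Strict complementarity and dual non-degeneracy assumption in the context holds with constants $\lambda_{Z_\star},\gamma_Q>0$, and the feasible set $\mathcal{M}_r=\{U\in\mathbb{R}^{n\times r}:\mathcal{A}(UU^\top)=b\}$ is a smooth manifold. Then there exist a neighborhood of $U_\star$ and a positive constant $c>0$ such that for all $U\in\mathbb{R}^{n\times r}$ in this neighborhood for which $X=UU^\top$ is feasible, $$\|Q_2^\top XQ_2\|_*\ge c\cdot\mathrm{dist}(U,U_\star)^2,$$ where the constant $c$ is $$c=\frac{1}{2\kappa+1},\qquad \kappa=\frac{4\lambda_1(X_\star)}{\lambda_{r_\star}(X_\star)}\cdot\frac{\sum_{i=1}^k\|Q_2^\top A_iQ_1\|_F^2}{\gamma_Q}.$$ Consequently, $\varphi_f(U)=\langle C,UU^\top\rangle$ has local quadratic growth around $U_\star$ on the feasible set with constant $\alpha_{\varphi_f}=2c\lambda_{Z_\star}$: for all $U\in\mathcal{M}_r$ near $U_\star$, $\varphi_f(U)-\varphi_f(U_\star)\ge\frac{\alpha_{\varphi_f}}{2}\mathrm{dist}(U,U_\star)^2$.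
   Context: $\mathbb{S}^n$ is the space of symmetric $n\times n$ matrices with Frobenius inner product; $C\in\mathbb{S}^n$; $\mathcal{A}:\mathbb{S}^n\to\mathbb{R}^k$, $[\mathcal{A}(X)]_i=\langle A_i,X\rangle$ with $A_i\in\mathbb{S}^n$; $b\in\mathbb{R}^k$. $\lambda_i(\cdot)$ is the $i$-th largest eigenvalue, $\|\cdot\|_*$ the nuclear norm, $\|\cdot\|_F$ the Frobenius norm. $X_\star=Q_1\Sigma_xQ_1^\top$ is the eigenvalue decomposition, with $Q_1\in\mathbb{R}^{n\times r_\star}$ having orthonormal columns and $\Sigma_x\in\mathbb{R}^{r_\star\times r_\star}$ diagonal positive definite, and $Q_2\in\mathbb{R}^{n\times(n-r_\star)}$ is such that $[Q_1,Q_2]$ is orthogonal. $\mathrm{dist}(U,U_\star)=\min_{\Omega\in\mathbb{R}^{r\times r},\,\Omega^\top\Omega=I_r}\|U-U_\star\Omega\|_F$. Strict complementarity and dual non-degeneracy. There is a dual optimal pair $(y_\star,Z_\star)$, i.e. $y_\star\in\mathbb{R}^k$, $Z_\star\succeq0$, $C+\sum_{i=1}^k(y_\star)_iA_i-Z_\star=0$, $\langle Z_\star,X_\star\rangle=0$, such that the $(r_\star+1)$-th smallest singular value of $Z_\star$ is at least $\lambda_{Z_\star}>0$; and there is $\gamma_Q>0$ with $\sum_{i=1}^k\langle Q_1^\top A_iQ_1,W\rangle^2\ge\gamma_Q\|W\|_F^2$ for all $W\in\mathbb{S}^{r_\star}$.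
   Formalization: In the degenerate case κ = 0 (all Q₂ᵀA_iQ₁ = 0) the stated constant c = 1 can fail (e.g. A₁ = I, b = 1, C = diag(0,1), U⋆ = e₁), so there both conclusions are asserted for every c in (0,1) instead; for κ > 0 the constant is c = 1/(2κ+1) as stated. *)

theory Defs
  imports "HOL-Analysis.Analysis" "HOL-Computational_Algebra.Polynomial"
begin

(* Sizes are index types: CARD('n) = n, CARD('r) = r, CARD('k) = k, CARD('s) = r_star and
   CARD('t) = n - r_star.  On real ^ 'm ^ 'n the library's inner product and norm are the
   Frobenius ones. *)

definition symmetric_matrix :: "real ^ 'n ^ 'n \<Rightarrow> bool" where
  "symmetric_matrix M \<longleftrightarrow> transpose M = M"

definition psd :: "real ^ 'n ^ 'n \<Rightarrow> bool" where
  "psd M \<longleftrightarrow> symmetric_matrix M \<and> (\<forall>v. 0 \<le> v \<bullet> (M *v v))"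

definition pos_def :: "real ^ 'n ^ 'n \<Rightarrow> bool" where
  "pos_def M \<longleftrightarrow> symmetric_matrix M \<and> (\<forall>v. v \<noteq> 0 \<longrightarrow> 0 < v \<bullet> (M *v v))"

definition diagonal_matrix :: "real ^ 'n ^ 'n \<Rightarrow> bool" where
  "diagonal_matrix M \<longleftrightarrow> (\<forall>i j. i \<noteq> j \<longrightarrow> M $ i $ j = 0)"

definition charpoly :: "real ^ 'n ^ 'n \<Rightarrow> real poly" where
  "charpoly M = det (\<chi> i j. (if i = j then [:0, 1:] else 0) - [:M $ i $ j:])"

(* Only real roots are counted; for the symmetric matrices to which this is applied
   there are exactly CARD('n) of them. *)
definition eigenvalues :: "real ^ 'n ^ 'n \<Rightarrow> real multiset" where
  "eigenvalues M = proots (charpoly M)"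

(* The index starts at 1. *)
definition nth_largest_eigenvalue :: "nat \<Rightarrow> real ^ 'n ^ 'n \<Rightarrow> real" where
  "nth_largest_eigenvalue i M = rev (sorted_list_of_multiset (eigenvalues M)) ! (i - 1)"

definition singular_values :: "real ^ 'n ^ 'n \<Rightarrow> real multiset" where
  "singular_values M = image_mset sqrt (eigenvalues (transpose M ** M))"

(* The index starts at 1. *)
definition nth_smallest_singular_value :: "nat \<Rightarrow> real ^ 'n ^ 'n \<Rightarrow> real" where
  "nth_smallest_singular_value i M = sorted_list_of_multiset (singular_values M) ! (i - 1)"

definition nuclear_norm :: "real ^ 'n ^ 'n \<Rightarrow> real" where
  "nuclear_norm M = sum_mset (singular_values M)"

definition hcat :: "real ^ 's ^ 'n \<Rightarrow> real ^ 't ^ 'n \<Rightarrow> real ^ ('s + 't) ^ 'n" where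
  "hcat P Q = (\<chi> i j. case j of Inl a \<Rightarrow> P $ i $ a | Inr b \<Rightarrow> Q $ i $ b)"

(* The library's orthogonal_matrix requires equal row and column index types; this is the
   same condition for two index types, which then have equal cardinality. *)
definition orthogonal_matrix2 :: "real ^ 'm ^ 'n \<Rightarrow> bool" where
  "orthogonal_matrix2 Q \<longleftrightarrow> transpose Q ** Q = mat 1 \<and> Q ** transpose Q = mat 1"

definition constraint_map :: "('k \<Rightarrow> real ^ 'n ^ 'n) \<Rightarrow> real ^ 'n ^ 'n \<Rightarrow> real ^ 'k" where
  "constraint_map A X = (\<chi> i. A i \<bullet> X)"

definition sdp_feasible ::
    "('k \<Rightarrow> real ^ 'n ^ 'n) \<Rightarrow> real ^ 'k \<Rightarrow> real ^ 'n ^ 'n \<Rightarrow> bool" where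
  "sdp_feasible A b X \<longleftrightarrow> constraint_map A X = b \<and> psd X"

definition sdp_solution ::
    "real ^ 'n ^ 'n \<Rightarrow> ('k \<Rightarrow> real ^ 'n ^ 'n) \<Rightarrow> real ^ 'k \<Rightarrow> real ^ 'n ^ 'n \<Rightarrow> bool" where
  "sdp_solution C A b X \<longleftrightarrow>
     sdp_feasible A b X \<and> (\<forall>Y. sdp_feasible A b Y \<longrightarrow> C \<bullet> X \<le> C \<bullet> Y)"

definition dual_optimal_pair ::
    "real ^ 'n ^ 'n \<Rightarrow> ('k::finite \<Rightarrow> real ^ 'n ^ 'n) \<Rightarrow> real ^ 'n ^ 'n \<Rightarrow>
     real ^ 'k \<Rightarrow> real ^ 'n ^ 'n \<Rightarrow> bool" where
  "dual_optimal_pair C A X y Z \<longleftrightarrow>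
     psd Z \<and> C + (\<Sum>i\<in>UNIV. (y $ i) *\<^sub>R A i) - Z = 0 \<and> Z \<bullet> X = 0"

definition factor_feasible_set ::
    "('k \<Rightarrow> real ^ 'n ^ 'n) \<Rightarrow> real ^ 'k \<Rightarrow> (real ^ 'r ^ 'n) set" where
  "factor_feasible_set A b = {U. constraint_map A (U ** transpose U) = b}"

(* The infimum is a minimum, since the orthogonal matrices form a compact set. *)
definition orbit_dist :: "real ^ 'r ^ 'n \<Rightarrow> real ^ 'r ^ 'n \<Rightarrow> real" where
  "orbit_dist U V = (INF \<Omega>\<in>{\<Omega> :: real ^ 'r ^ 'r. transpose \<Omega> ** \<Omega> = mat 1}. norm (U - V ** \<Omega>))"

(* Meant for open S: continuous partial derivatives up to the given order. *)
primrec Ck_on :: "nat \<Rightarrow> 'a::euclidean_space set \<Rightarrow> ('a \<Rightarrow> 'b::euclidean_space) \<Rightarrow> bool" where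
  "Ck_on 0 S f \<longleftrightarrow> continuous_on S f"
| "Ck_on (Suc k) S f \<longleftrightarrow>
     (\<forall>x\<in>S. f differentiable (at x)) \<and>
     (\<forall>v. Ck_on k S (\<lambda>x. frechet_derivative f (at x) v))"

definition smooth_on :: "'a::euclidean_space set \<Rightarrow> ('a \<Rightarrow> 'b::euclidean_space) \<Rightarrow> bool" where
  "smooth_on S f \<longleftrightarrow> (\<forall>k. Ck_on k S f)"

(* Embedded smooth submanifold (without boundary) of the ambient Euclidean space, given by
   slice charts; the common model subspace T fixes its dimension. *)
definition smooth_submanifold :: "'a::euclidean_space set \<Rightarrow> bool" where
  "smooth_submanifold M \<longleftrightarrow>
     (\<exists>T :: 'a set. subspace T \<and>
       (\<forall>p\<in>M. \<exists>V W \<phi> \<psi>. open V \<and> p \<in> V \<and> open W \<and> homeomorphism V W \<phi> \<psi> \<and>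
          smooth_on V \<phi> \<and> smooth_on W \<psi> \<and> \<phi> ` (M \<inter> V) = T \<inter> W))"

definition local_quadratic_growth ::
    "(real ^ 'r ^ 'n \<Rightarrow> real) \<Rightarrow> (real ^ 'r ^ 'n) set \<Rightarrow> real ^ 'r ^ 'n \<Rightarrow> real \<Rightarrow> bool" where
  "local_quadratic_growth f M V \<alpha> \<longleftrightarrow>
     (\<exists>N. open N \<and> V \<in> N \<and>
       (\<forall>U\<in>N \<inter> M. f U - f V \<ge> \<alpha> / 2 * (orbit_dist U V)\<^sup>2))"

(* The growth constant c equals 1 / (2 \<kappa> + 1) whenever \<kappa> is nonzero.  For \<kappa> = 0 that value
   would be 1, and the estimate fails: take n = 2, r = k = 1, A_1 = I, b = 1, C = diag(0, 1),
   U_star = e_1.  Feasible U = (cos t, sin t) near e_1 give nuclear norm (sin t)^2 and squared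
   distance 4 (sin (t/2))^2, which is larger than (sin t)^2 for small t other than 0.
   In that case every constant below 1 is available. *)
definition admissible_constant :: "real \<Rightarrow> real \<Rightarrow> bool" where
  "admissible_constant \<kappa> c \<longleftrightarrow> (if \<kappa> = 0 then 0 < c \<and> c < 1 else c = 1 / (2 * \<kappa> + 1))"

end

theory Submission
  imports Defs
begin

text \<open>
Write $V = Q_1^T U$ and $W = Q_2^T U$ for the parts of a factor $U$ inside and outside the range of
$X_\star$, and $G = Q_1^T U_\star$, so that $G G^T = \<Sigma>_x$ and $Q_2^T U_\star = 0$. The nuclear norm of
$Q_2^T U U^T Q_2$ is at least its trace $\|W\|^2$, so everything reduces to
$c \cdot dist(U, U_\star)^2 \<le> \|W\|^2$ for feasible $U$ near $U_\star$.

The distance is controlled by a Procrustes argument. Choose the orthogonal $\<Omega>$ that maximizes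
$\langle V, G \<Omega> \rangle$. Optimality makes $(G \<Omega>)^T V$ positive semidefinite, hence $V = T G \<Omega>$ with
$T$ positive semidefinite, and this gives
$\<lambda>_{r_\star} \|V - G \<Omega>\|^2 \<le> \|V V^T - \<Sigma>_x\|^2$ without any smallness assumption. Rotating $U_\star$ by
$\<Omega>$ yields $dist(U, U_\star)^2 \<le> \|V V^T - \<Sigma>_x\|^2 / \<lambda>_{r_\star} + \|W\|^2$
(\<open>orbit_dist_le_gram_defect\<close>).

Feasibility and dual non-degeneracy control the Gram defect $V V^T - \<Sigma>_x$. Subtracting the constraint
equations at $U$ and $U_\star$ expresses $\langle Q_1^T A_i Q_1, V V^T - \<Sigma>_x \rangle$ through $W V^T$ and
$W W^T$, and near $U_\star$ these are at most $(\sqrt{\<lambda>_1} + o(1)) \|W\|$ and $o(1) \|W\|$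
(\<open>gram_defect_bound\<close>). Together,
$dist(U, U_\star)^2 \<le> (\<kappa> + 1 + o(1)) \|W\|^2$. Every admissible $c$ satisfies
$c (\<kappa> + 1) < 1$, and this slack absorbs the error term on a small enough ball.

For quadratic growth, $\varphi_f(U) - \varphi_f(U_\star) = \langle Z_\star, U U^T \rangle$ on the feasible set.
Since $Z_\star$ vanishes on the range of $Q_1$, strict complementarity makes it at least $\<lambda>_{Z_\star}$ on
the range of $Q_2$ (\<open>dual_certificate_bound\<close>), so the difference is at least
$\<lambda>_{Z_\star} \|W\|^2$ and the first estimate applies.

Eigenvalues and singular values are multisets of roots of a characteristic polynomial. Linking them to
quadratic forms needs the spectral theorem; like the Procrustes alignment, it is obtained by maximizing a
continuous function over the compact orthogonal group and testing the maximizer against plane rotations and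
reflections.
\<close>

section \<open>Frobenius inner product and matrix algebra\<close>

lemma frobenius_inner: "(M :: real ^ 'm ^ 'n) \<bullet> N = (\<Sum>i\<in>UNIV. \<Sum>j\<in>UNIV. M $ i $ j * N $ i $ j)"
  by (simp add: inner_vec_def)

lemma power2_norm_matrix: "(norm (M :: real ^ 'm ^ 'n))\<^sup>2 = (\<Sum>i\<in>UNIV. \<Sum>j\<in>UNIV. (M $ i $ j)\<^sup>2)"
  unfolding power2_norm_eq_inner frobenius_inner by (simp add: power2_eq_square)

lemma trace_eq_inner_mat_1: "trace M = M \<bullet> (mat 1 :: real ^ 'n ^ 'n)"
  by (simp add: trace_def frobenius_inner mat_def if_distrib if_distribR cong: if_cong)

lemma transpose_add: "transpose ((M :: real ^ 'm ^ 'n) + N) = transpose M + transpose N"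
  by (simp add: transpose_def vec_eq_iff)

lemma transpose_diff: "transpose ((M :: real ^ 'm ^ 'n) - N) = transpose M - transpose N"
  by (simp add: transpose_def vec_eq_iff)

lemma matrix_diff_ldistrib: "(M :: real ^ 'm ^ 'n) ** (N - P) = M ** N - M ** P"
  by (simp add: matrix_matrix_mult_def vec_eq_iff right_diff_distrib sum_subtractf)

lemma matrix_diff_rdistrib: "((M :: real ^ 'm ^ 'n) - N) ** P = M ** P - N ** P"
  by (simp add: matrix_matrix_mult_def vec_eq_iff left_diff_distrib sum_subtractf)

lemma matrix_add_rdistrib: "((M :: real ^ 'm ^ 'n) + N) ** P = M ** P + N ** P"
  by (simp add: matrix_matrix_mult_def vec_eq_iff distrib_right sum.distrib)

lemmas matrix_distribs =
  matrix_add_ldistrib matrix_add_rdistrib matrix_diff_ldistrib matrix_diff_rdistrib transpose_add transpose_diff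

lemma inner_transpose: "transpose (M :: real ^ 'm ^ 'n) \<bullet> transpose N = M \<bullet> N"
  unfolding frobenius_inner transpose_def by (simp, rule sum.swap)

lemma norm_transpose: "norm (transpose (M :: real ^ 'm ^ 'n)) = norm M"
  by (simp add: norm_eq_sqrt_inner inner_transpose)

lemma inner_matrix_mult_left:
  fixes M :: "real ^ 'm ^ 'n"
  shows "(M ** N) \<bullet> P = N \<bullet> (transpose M ** P)"
proof -
  have "(M ** N) \<bullet> P = (\<Sum>i\<in>UNIV. \<Sum>j\<in>UNIV. \<Sum>k\<in>UNIV. M $ i $ k * N $ k $ j * P $ i $ j)"
    by (simp add: frobenius_inner matrix_matrix_mult_def sum_distrib_right)
  also have "\<dots> = (\<Sum>i\<in>UNIV. \<Sum>k\<in>UNIV. \<Sum>j\<in>UNIV. M $ i $ k * N $ k $ j * P $ i $ j)"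
    by (intro sum.cong refl sum.swap)
  also have "\<dots> = (\<Sum>k\<in>UNIV. \<Sum>i\<in>UNIV. \<Sum>j\<in>UNIV. M $ i $ k * N $ k $ j * P $ i $ j)"
    by (rule sum.swap)
  also have "\<dots> = (\<Sum>k\<in>UNIV. \<Sum>j\<in>UNIV. \<Sum>i\<in>UNIV. M $ i $ k * N $ k $ j * P $ i $ j)"
    by (intro sum.cong refl sum.swap)
  also have "\<dots> = N \<bullet> (transpose M ** P)"
    by (simp add: frobenius_inner matrix_matrix_mult_def transpose_def sum_distrib_left mult_ac)
  finally show ?thesis .
qed

lemma inner_matrix_mult_right:
  fixes M :: "real ^ 'm ^ 'n"
  shows "(M ** N) \<bullet> P = M \<bullet> (P ** transpose N)"
proof -
  have "(M ** N) \<bullet> P = (transpose N ** transpose M) \<bullet> transpose P"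
    by (metis inner_transpose matrix_transpose_mul)
  also have "\<dots> = transpose M \<bullet> transpose (P ** transpose N)"
    by (simp add: inner_matrix_mult_left matrix_transpose_mul)
  finally show ?thesis by (simp add: inner_transpose)
qed

lemma inner_two_sided_mult:
  fixes P :: "real ^ 'm ^ 'n"
  shows "(P ** N ** transpose R) \<bullet> M = N \<bullet> (transpose P ** M ** R)"
  by (simp add: inner_matrix_mult_right[of "P ** N"] inner_matrix_mult_left[of P] matrix_mul_assoc)

text \<open>Each entry of the product is an inner product of a row and a column, so Cauchy-Schwarz applies
entrywise.\<close>
lemma norm_matrix_mult_le:
  fixes M :: "real ^ 'm ^ 'n" and N :: "real ^ 'p ^ 'm"
  shows "norm (M ** N) \<le> norm M * norm N"
proof -
  have e: "(M ** N) $ i $ j = M $ i \<bullet> (transpose N) $ j" for i j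
    by (simp add: matrix_matrix_mult_def inner_vec_def transpose_def)
  have "(norm (M ** N))\<^sup>2 = (\<Sum>i\<in>UNIV. \<Sum>j\<in>UNIV. (M $ i \<bullet> (transpose N) $ j)\<^sup>2)"
    unfolding power2_norm_eq_inner frobenius_inner by (simp add: e power2_eq_square)
  also have "\<dots> \<le> (\<Sum>i\<in>UNIV. \<Sum>j\<in>UNIV. (M $ i \<bullet> M $ i) * ((transpose N) $ j \<bullet> (transpose N) $ j))"
    by (intro sum_mono Cauchy_Schwarz_ineq)
  also have "\<dots> = (M \<bullet> M) * (transpose N \<bullet> transpose N)"
    by (simp add: sum_product inner_vec_def[of M M] inner_vec_def[of "transpose N" "transpose N"])
  also have "\<dots> = (norm M * norm N)\<^sup>2"
    by (simp add: inner_transpose power_mult_distrib power2_norm_eq_inner)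
  finally show ?thesis by (rule power2_le_imp_le) simp
qed

lemma inner_mult_transpose_eq_sum:
  fixes M :: "real ^ 'n ^ 'n" and V :: "real ^ 'r ^ 'n"
  shows "M \<bullet> (V ** transpose V) = (\<Sum>a\<in>UNIV. column a V \<bullet> (M *v column a V))"
proof -
  have "M \<bullet> (V ** transpose V) = (\<Sum>i\<in>UNIV. \<Sum>j\<in>UNIV. \<Sum>a\<in>UNIV. V $ i $ a * (M $ i $ j * V $ j $ a))"
    by (simp add: frobenius_inner matrix_matrix_mult_def transpose_def sum_distrib_left mult_ac)
  also have "\<dots> = (\<Sum>i\<in>UNIV. \<Sum>a\<in>UNIV. \<Sum>j\<in>UNIV. V $ i $ a * (M $ i $ j * V $ j $ a))"
    by (intro sum.cong refl sum.swap)
  also have "\<dots> = (\<Sum>a\<in>UNIV. \<Sum>i\<in>UNIV. \<Sum>j\<in>UNIV. V $ i $ a * (M $ i $ j * V $ j $ a))"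
    by (rule sum.swap)
  finally show ?thesis
    by (simp add: inner_vec_def matrix_vector_mult_def column_def sum_distrib_left)
qed

lemma inner_transpose_matrix_vector: "v \<bullet> (transpose M *v w) = (M *v v) \<bullet> (w :: real ^ 'n)"
  using dot_lmul_matrix[of w M v] by (simp add: inner_commute)

definition diag :: "('n \<Rightarrow> real) \<Rightarrow> real ^ 'n ^ 'n" where
  "diag d = (\<chi> i j. if i = j then d i else 0)"

lemma diag_matrix_mult_nth: "(diag d ** M) $ i $ j = d i * M $ i $ j"
  unfolding diag_def matrix_matrix_mult_def by (simp add: if_distrib if_distribR cong: if_cong)

lemma matrix_mult_diag_nth: "(M ** diag d) $ i $ j = M $ i $ j * d j"
  unfolding diag_def matrix_matrix_mult_def by (simp add: if_distrib if_distribR cong: if_cong)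

lemma diag_mult: "diag d ** diag e = diag (\<lambda>i. d i * e i)"
  by (simp add: vec_eq_iff diag_matrix_mult_nth) (simp add: diag_def)

lemma transpose_diag [simp]: "transpose (diag d) = diag d"
  by (auto simp: diag_def transpose_def vec_eq_iff)

section \<open>Positive semidefinite matrices\<close>

text \<open>The first-order optimality condition without derivatives: a linear term cannot stay below a
quadratic one near zero unless it vanishes.\<close>
lemma linear_term_zero_of_quadratic_bound:
  fixes a d :: real
  assumes "\<And>t. t * d \<le> t\<^sup>2 * a"
  shows "d = 0"
proof (rule ccontr)
  assume "d \<noteq> 0"
  define t where "t = d / (\<bar>a\<bar> + 1)"
  have "t * d = t\<^sup>2 * (\<bar>a\<bar> + 1)"
    unfolding t_def power2_eq_square by (simp add: divide_simps)
  then have "t\<^sup>2 * (\<bar>a\<bar> + 1) \<le> t\<^sup>2 * a" using assms[of t] by simp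
  moreover have "t\<^sup>2 > 0" using \<open>d \<noteq> 0\<close> by (simp add: t_def)
  ultimately show False by simp
qed

lemma psd_inner_mult_transpose_nonneg:
  assumes "psd M" shows "0 \<le> M \<bullet> (V ** transpose V)"
  using assms unfolding inner_mult_transpose_eq_sum psd_def by (intro sum_nonneg) auto

text \<open>The quadratic form is nonnegative along every line through $v$ and attains the value zero at $v$, so
its derivative there vanishes.\<close>
lemma psd_kernel:
  assumes "psd Z" "v \<bullet> (Z *v v) = 0"
  shows "Z *v v = 0"
proof -
  have sym: "v \<bullet> (Z *v w) = w \<bullet> (Z *v v)" for w
    using assms(1) inner_transpose_matrix_vector[of v Z w] by (simp add: psd_def symmetric_matrix_def inner_commute)
  have "2 * (w \<bullet> (Z *v v)) = 0" for w
  proof (rule linear_term_zero_of_quadratic_bound[of _ "w \<bullet> (Z *v w)"])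
    fix t :: real
    have "0 \<le> (v - t *\<^sub>R w) \<bullet> (Z *v (v - t *\<^sub>R w))" using assms(1) by (simp add: psd_def)
    also have "\<dots> = v \<bullet> (Z *v v) - t * (w \<bullet> (Z *v v)) - t * (v \<bullet> (Z *v w)) + t\<^sup>2 * (w \<bullet> (Z *v w))"
      by (simp add: matrix_vector_mult_diff_distrib matrix_vector_mult_scaleR inner_diff_left inner_diff_right
          power2_eq_square algebra_simps)
    finally show "t * (2 * (w \<bullet> (Z *v v))) \<le> t\<^sup>2 * (w \<bullet> (Z *v w))" by (simp add: assms(2) sym[of w])
  qed
  from this[of "Z *v v"] show ?thesis by simp
qed

lemma psd_congruence:
  assumes "psd M" shows "psd (transpose B ** M ** B)"
  unfolding psd_def symmetric_matrix_def
proof (intro conjI allI)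
  show "transpose (transpose B ** M ** B) = transpose B ** M ** B"
    using assms by (simp add: psd_def symmetric_matrix_def matrix_transpose_mul matrix_mul_assoc)
  fix v
  have "v \<bullet> ((transpose B ** M ** B) *v v) = (B *v v) \<bullet> (M *v (B *v v))"
    by (simp only: flip: inner_transpose_matrix_vector matrix_vector_mul_assoc)
  then show "0 \<le> v \<bullet> ((transpose B ** M ** B) *v v)" using assms by (simp add: psd_def)
qed

lemma psd_diag_iff: "psd (diag d) \<longleftrightarrow> (\<forall>i. 0 \<le> d i)"
proof -
  have q: "v \<bullet> (diag d *v v) = (\<Sum>i\<in>UNIV. d i * (v $ i)\<^sup>2)" for v
    by (simp add: inner_vec_def matrix_vector_mult_def diag_def if_distrib if_distribR power2_eq_square
        mult_ac cong: if_cong)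
  have "axis i 1 \<bullet> (diag d *v axis i 1) = d i" for i
    by (simp add: q axis_def if_distrib if_distribR cong: if_cong)
  then show ?thesis
    by (auto simp: psd_def symmetric_matrix_def q intro!: sum_nonneg) metis
qed

section \<open>Plane rotations\<close>

definition matrix_unit :: "'n \<Rightarrow> 'n \<Rightarrow> real ^ 'n ^ 'n" where
  "matrix_unit i j = (\<chi> a b. if a = i \<and> b = j then 1 else 0)"

lemma matrix_unit_mult: "matrix_unit i j ** matrix_unit k l = (if j = k then matrix_unit i l else 0)"
proof -
  have "(\<Sum>x\<in>UNIV. (if a = i \<and> x = j then 1 else 0) * (if x = k \<and> b = l then 1 else 0))
      = (if j = k \<and> a = i \<and> b = l then 1 else (0::real))" for a b
    by (subst sum.remove[of _ j]) (auto intro!: sum.neutral)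
  then show ?thesis
    by (auto simp: matrix_unit_def matrix_matrix_mult_def vec_eq_iff)
qed

lemma matrix_unit_matrix_mult: "matrix_unit k l ** M = (\<chi> a b. if a = k then M $ l $ b else 0)"
proof -
  have "(\<Sum>x\<in>UNIV. (if a = k \<and> x = l then 1 else 0) * M $ x $ b) = (if a = k then M $ l $ b else 0)" for a b
    by (subst sum.remove[of _ l]) (auto intro!: sum.neutral)
  then show ?thesis by (simp add: matrix_unit_def matrix_matrix_mult_def vec_eq_iff)
qed

lemma transpose_matrix_unit: "transpose (matrix_unit i j) = matrix_unit j i"
  by (auto simp: matrix_unit_def transpose_def vec_eq_iff)

lemma inner_matrix_unit: "M \<bullet> matrix_unit i j = M $ i $ j"
proof -
  have "M \<bullet> matrix_unit i j = (\<Sum>a\<in>UNIV. \<Sum>b\<in>UNIV. if b = j then if a = i then M $ a $ b else 0 else 0)"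
    unfolding frobenius_inner by (intro sum.cong refl) (auto simp: matrix_unit_def)
  then show ?thesis by simp
qed

text \<open>The rotation by $(c, s)$ in a coordinate plane, written additively so that products reduce to the
multiplication table of matrix units.\<close>
definition givens_rotation :: "'n \<Rightarrow> 'n \<Rightarrow> real \<Rightarrow> real \<Rightarrow> real ^ 'n ^ 'n" where
  "givens_rotation i j c s = mat 1 + (c - 1) *\<^sub>R (matrix_unit i i + matrix_unit j j)
     + s *\<^sub>R (matrix_unit j i - matrix_unit i j)"

text \<open>The plane projection $J$ and its quarter turn $K$ satisfy $J^2 = J$, $JK = KJ = K$, $K^2 = -J$, so
they multiply like the complex numbers $1$ and $i$, and the claim is $|c + i s| = 1$.\<close>
lemma orthogonal_givens_rotation:
  fixes i j :: "'n::finite"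
  assumes "i \<noteq> j" "c\<^sup>2 + s\<^sup>2 = 1"
  shows "orthogonal_matrix (givens_rotation i j c s)"
proof -
  define J :: "real ^ 'n ^ 'n" where "J = matrix_unit i i + matrix_unit j j"
  define K where "K = matrix_unit j i - matrix_unit i j"
  have [simp]: "transpose J = J" "transpose K = - K"
    by (simp_all add: J_def K_def transpose_add transpose_diff transpose_matrix_unit)
  have p: "J ** J = J" "J ** K = K" "K ** J = K" "K ** K = - J"
    using \<open>i \<noteq> j\<close>
    by (auto simp: J_def K_def matrix_distribs matrix_unit_mult)
  have s2: "s * s = 1 - c * c" using assms(2) by (simp add: power2_eq_square)
  have "transpose (givens_rotation i j c s) ** givens_rotation i j c s
      = (mat 1 + (c - 1) *\<^sub>R J - s *\<^sub>R K) ** (mat 1 + (c - 1) *\<^sub>R J + s *\<^sub>R K)"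
    by (simp add: givens_rotation_def J_def[symmetric] K_def[symmetric] transpose_add transpose_scalar)
  also have "\<dots> = mat 1 + (2 * (c - 1) + (c - 1) * (c - 1) + s * s) *\<^sub>R J"
    by (simp add: matrix_distribs p scalar_matrix_assoc[symmetric] matrix_scalar_ac  algebra_simps scaleR_2)
  also have "\<dots> = mat 1" unfolding s2 by (simp add: algebra_simps)
  finally show ?thesis by (simp add: orthogonal_matrix)
qed

text \<open>The change of a diagonal matrix under rotation lies in the coordinate plane of the rotation and is
proportional to the gap of the two diagonal entries. This is the variation that is tested in the
spectral theorem.\<close>
lemma givens_rotation_conjugate_diagonal:
  fixes w :: "'n::finite \<Rightarrow> real"
  assumes "i \<noteq> j" "c\<^sup>2 + s\<^sup>2 = 1"
  defines "N \<equiv> diag w"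
  shows "givens_rotation i j c s ** N ** transpose (givens_rotation i j c s)
    = N + (w i - w j) *\<^sub>R (s\<^sup>2 *\<^sub>R (matrix_unit j j - matrix_unit i i)
        + (c * s) *\<^sub>R (matrix_unit i j + matrix_unit j i))"
    (is "?R ** N ** transpose ?R = N + (w i - w j) *\<^sub>R ?X")
proof -
  have R: "?R $ k $ l = (if l = i then if k = i then c else if k = j then s else 0
      else if l = j then if k = j then c else if k = i then - s else 0
      else if k = l then 1 else 0)" for k l
    using assms(1) by (auto simp: givens_rotation_def matrix_unit_def mat_def)
  have "?X ** ?R = s\<^sup>2 *\<^sub>R (matrix_unit j j ** ?R - matrix_unit i i ** ?R)
      + (c * s) *\<^sub>R (matrix_unit i j ** ?R + matrix_unit j i ** ?R)"
    by (simp add: matrix_add_rdistrib matrix_diff_rdistrib flip: scalar_matrix_assoc)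
  then have XR: "(?X ** ?R) $ a $ b = s\<^sup>2 * ((if a = j then ?R $ j $ b else 0) - (if a = i then ?R $ i $ b else 0))
      + c * s * ((if a = i then ?R $ j $ b else 0) + (if a = j then ?R $ i $ b else 0))" for a b
    by (simp add: matrix_unit_matrix_mult)
  have "(?R ** N) $ a $ b = ((N + (w i - w j) *\<^sub>R ?X) ** ?R) $ a $ b" for a b
  proof -
    have "?R $ a $ b * w b = w a * ?R $ a $ b + (w i - w j) * (?X ** ?R) $ a $ b"
    proof (cases "b = i \<or> b = j")
      case False
      then show ?thesis unfolding XR R using assms(1) by auto
    next
      case True
      have "c * (c * (s * x)) + s * (s * (s * x)) = s * x" for x
        using assms(2) by algebra
      from this[of "w i"] this[of "w j"] show ?thesis unfolding XR R using assms(1) True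
        by (auto simp: algebra_simps power2_eq_square)
    qed
    then show ?thesis
      by (simp add: N_def diag_matrix_mult_nth matrix_mult_diag_nth matrix_add_rdistrib flip: scalar_matrix_assoc)
  qed
  then have "?R ** N = (N + (w i - w j) *\<^sub>R ?X) ** ?R" by (simp add: vec_eq_iff)
  then have "?R ** N ** transpose ?R = (N + (w i - w j) *\<^sub>R ?X) ** (?R ** transpose ?R)"
    by (simp add: matrix_mul_assoc)
  also have "?R ** transpose ?R = mat 1"
    using orthogonal_givens_rotation[OF assms(1,2)] by (simp add: orthogonal_matrix_def)
  finally show ?thesis by simp
qed

lemma unit_circle_rational_point:
  fixes t :: real
  shows "((1 - t\<^sup>2) / (1 + t\<^sup>2))\<^sup>2 + (2 * t / (1 + t\<^sup>2))\<^sup>2 = 1"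
proof -
  have n: "1 + t\<^sup>2 \<noteq> 0" using zero_le_power2[of t] by linarith
  have "((1 - t\<^sup>2)\<^sup>2 + (2 * t)\<^sup>2) = (1 + t\<^sup>2)\<^sup>2"
    by (simp add: power2_eq_square algebra_simps)
  then show ?thesis using n by (simp add: power_divide flip: add_divide_distrib)
qed

section \<open>Maximizers over the orthogonal group\<close>

lemma continuous_on_matrix_mult [continuous_intros]:
  fixes f :: "'a::topological_space \<Rightarrow> real ^ 'm ^ 'n" and g :: "'a \<Rightarrow> real ^ 'p ^ 'm"
  assumes "continuous_on S f" "continuous_on S g"
  shows "continuous_on S (\<lambda>x. f x ** g x)"
  unfolding matrix_matrix_mult_def by (intro continuous_intros assms)

lemma continuous_on_transpose [continuous_intros]:
  fixes f :: "'a::topological_space \<Rightarrow> real ^ 'm ^ 'n"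
  assumes "continuous_on S f"
  shows "continuous_on S (\<lambda>x. transpose (f x))"
  unfolding transpose_def by (intro continuous_intros assms)

lemma compact_orthogonal_matrices: "compact {P :: real ^ 'n ^ 'n. orthogonal_matrix P}"
proof -
  have "norm P = norm (mat 1 :: real ^ 'n ^ 'n)" if "orthogonal_matrix P" for P :: "real ^ 'n ^ 'n"
  proof -
    have "P \<bullet> P = (mat 1 :: real ^ 'n ^ 'n) \<bullet> mat 1"
      using that inner_matrix_mult_left[of P "mat 1" P] by (simp add: orthogonal_matrix)
    then show ?thesis by (simp add: norm_eq_sqrt_inner)
  qed
  then have "bounded {P :: real ^ 'n ^ 'n. orthogonal_matrix P}"
    unfolding bounded_iff by (metis (lifting) mem_Collect_eq order_refl)
  moreover have "closed {P :: real ^ 'n ^ 'n. orthogonal_matrix P}"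
    unfolding orthogonal_matrix by (intro closed_Collect_eq continuous_intros)
  ultimately show ?thesis by (simp add: compact_eq_bounded_closed)
qed

lemma orthogonal_matrix_maximizer:
  fixes f :: "real ^ 'n ^ 'n \<Rightarrow> real"
  assumes "continuous_on UNIV f"
  obtains P where "orthogonal_matrix P" "\<And>R. orthogonal_matrix R \<Longrightarrow> f R \<le> f P"
proof -
  have "\<exists>P\<in>{P. orthogonal_matrix P}. \<forall>R\<in>{P. orthogonal_matrix P}. f R \<le> f P"
    using compact_orthogonal_matrices orthogonal_matrix_id continuous_on_subset[OF assms subset_UNIV]
    by (intro continuous_attains_sup) auto
  then show ?thesis using that by auto
qed

text \<open>Rotations in the plane of $i$ and $j$ change $\langle Y, R \rangle$ to first order by $Y_{ji} -
Y_{ij}$, which must vanish; the reflection along $v$ changes it by $-2 v^T Y v / |v|^2$, which must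
not be positive.\<close>
lemma psd_if_identity_maximizes_trace:
  fixes Y :: "real ^ 'n ^ 'n"
  assumes max: "\<And>R. orthogonal_matrix R \<Longrightarrow> Y \<bullet> R \<le> Y \<bullet> mat 1"
  shows "psd Y"
proof -
  have sym: "Y $ j $ i = Y $ i $ j" for i j
  proof (cases "i = j")
    case False
    have "Y $ j $ i - Y $ i $ j = 0"
    proof (rule linear_term_zero_of_quadratic_bound[of _ "Y $ i $ i + Y $ j $ j"])
      fix t :: real
      \<comment> \<open>A rational point of the unit circle that tends to $(1, 0)$ with $t$, so that
        the deviation from the identity is of order $t$ in $s$ and of order $t^2$ in $c$.\<close>
      define c where "c = (1 - t\<^sup>2) / (1 + t\<^sup>2)"
      define s where "s = 2 * t / (1 + t\<^sup>2)"
      have p: "1 + t\<^sup>2 > 0" by (simp add: add_pos_nonneg)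
      have cs: "(c - 1) * (1 + t\<^sup>2) = - 2 * t\<^sup>2" "s * (1 + t\<^sup>2) = 2 * t"
        using p by (simp_all add: c_def s_def field_simps)
      have "Y \<bullet> givens_rotation i j c s \<le> Y \<bullet> mat 1"
        using False unit_circle_rational_point
        by (intro max orthogonal_givens_rotation) (auto simp: c_def s_def)
      then have "(c - 1) * (Y $ i $ i + Y $ j $ j) + s * (Y $ j $ i - Y $ i $ j) \<le> 0"
        by (simp add: givens_rotation_def inner_add_right inner_diff_right inner_matrix_unit)
      then have "((c - 1) * (Y $ i $ i + Y $ j $ j) + s * (Y $ j $ i - Y $ i $ j)) * (1 + t\<^sup>2) \<le> 0"
        using p by (simp add: mult_le_0_iff)
      also have "((c - 1) * (Y $ i $ i + Y $ j $ j) + s * (Y $ j $ i - Y $ i $ j)) * (1 + t\<^sup>2)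
          = ((c - 1) * (1 + t\<^sup>2)) * (Y $ i $ i + Y $ j $ j) + (s * (1 + t\<^sup>2)) * (Y $ j $ i - Y $ i $ j)"
        by (simp add: algebra_simps)
      finally show "t * (Y $ j $ i - Y $ i $ j) \<le> t\<^sup>2 * (Y $ i $ i + Y $ j $ j)"
        unfolding cs by simp
    qed
    then show ?thesis by simp
  qed simp
  have pos: "0 \<le> v \<bullet> (Y *v v)" for v
  proof (cases "v = 0")
    case False
    define H :: "real ^ 'n ^ 'n" where "H = (\<chi> i j. v $ i * v $ j)"
    have vv: "v \<bullet> v > 0" using False by simp
    have HH: "H ** H = (v \<bullet> v) *\<^sub>R H"
      by (simp add: H_def matrix_matrix_mult_def vec_eq_iff inner_vec_def sum_distrib_left
          sum_distrib_right mult_ac)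
    have [simp]: "transpose H = H" by (simp add: H_def transpose_def vec_eq_iff mult.commute)
    have YH: "Y \<bullet> H = v \<bullet> (Y *v v)"
      by (simp add: H_def frobenius_inner inner_vec_def matrix_vector_mult_def sum_distrib_left mult_ac)
    \<comment> \<open>The reflection in the hyperplane orthogonal to $v$.\<close>
    define R where "R = mat 1 - (2 / (v \<bullet> v)) *\<^sub>R H"
    have "transpose R ** R = mat 1 - (4 / (v \<bullet> v)) *\<^sub>R H + ((2 / (v \<bullet> v)) * (2 / (v \<bullet> v)) * (v \<bullet> v)) *\<^sub>R H"
      by (simp add: R_def matrix_distribs transpose_scalar scalar_matrix_assoc[symmetric]
          matrix_scalar_ac HH algebra_simps flip: scaleR_add_left)
    also have "\<dots> = mat 1" using vv by simp
    finally have "Y \<bullet> R \<le> Y \<bullet> mat 1" by (intro max) (simp add: orthogonal_matrix)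
    then have "0 \<le> (2 / (v \<bullet> v)) * (v \<bullet> (Y *v v))"
      by (simp add: R_def inner_diff_right YH)
    then show ?thesis using vv by (simp add: zero_le_divide_iff)
  qed simp
  show ?thesis unfolding psd_def symmetric_matrix_def
    using sym pos by (simp add: transpose_def vec_eq_iff)
qed

text \<open>The maximizer of $\langle V, G \<Omega> \rangle$ aligns the two factors: after the substitution of
$\<Omega>$ the identity is the best rotation, and the preceding lemma applies.\<close>
lemma procrustes_rotation:
  fixes G V :: "real ^ 'r ^ 's"
  obtains \<Omega> where "orthogonal_matrix \<Omega>" "psd (transpose (G ** \<Omega>) ** V)"
proof -
  define B where "B = transpose G ** V"
  obtain P where P: "orthogonal_matrix P" "\<And>R. orthogonal_matrix R \<Longrightarrow> B \<bullet> R \<le> B \<bullet> P"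
    by (rule orthogonal_matrix_maximizer[of "\<lambda>P. B \<bullet> P"]) (auto intro!: continuous_intros)
  have "psd (transpose P ** B)"
  proof (rule psd_if_identity_maximizes_trace)
    fix R :: "real ^ 'r ^ 'r" assume "orthogonal_matrix R"
    then have "B \<bullet> (P ** R) \<le> B \<bullet> P" by (intro P(2) orthogonal_matrix_mul P(1))
    then show "(transpose P ** B) \<bullet> R \<le> (transpose P ** B) \<bullet> mat 1"
      by (simp add: inner_matrix_mult_left)
  qed
  then show ?thesis using P(1)
    by (intro that[of P]) (simp_all add: B_def matrix_transpose_mul matrix_mul_assoc)
qed

text \<open>Among all orthogonal $P$, maximize $\sum_a w_a (P^T M P)_{aa}$ with pairwise distinct weights $w_a$.
At the maximum no plane rotation improves the value. The first-order change is $2 (w_i - w_j)$ times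
the entry at $(i, j)$ of $P^T M P$, so all entries off the diagonal vanish.\<close>
lemma spectral_theorem:
  fixes M :: "real ^ 'n ^ 'n"
  assumes "symmetric_matrix M"
  obtains P d where "orthogonal_matrix P" "M = P ** diag d ** transpose P"
proof -
  obtain w :: "'n \<Rightarrow> nat" where w: "inj w"
    using finite_imp_inj_to_nat_seg[of "UNIV :: 'n set"] by auto
  define g where "g = (\<lambda>P :: real ^ 'n ^ 'n. \<Sum>a\<in>UNIV. real (w a) * (transpose P ** M ** P) $ a $ a)"
  obtain P where P: "orthogonal_matrix P" "\<And>R. orthogonal_matrix R \<Longrightarrow> g R \<le> g P"
    by (rule orthogonal_matrix_maximizer[of g]) (auto simp: g_def intro!: continuous_intros)
  define Y where "Y = transpose P ** M ** P"
  have symY: "transpose Y = Y"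
    using assms by (simp add: Y_def symmetric_matrix_def matrix_transpose_mul matrix_mul_assoc)
  have "Y $ i $ j = 0" if "i \<noteq> j" for i j
  proof -
    have Yji: "Y $ j $ i = Y $ i $ j" using symY by (metis transpose_def vec_lambda_beta)
    define N :: "real ^ 'n ^ 'n" where "N = diag (\<lambda>i. real (w i))"
    have g_eq: "g (P ** R) = N \<bullet> (transpose R ** Y ** R)" for R
    proof -
      have "g (P ** R) = (\<Sum>a\<in>UNIV. real (w a) * (transpose R ** Y ** R) $ a $ a)"
        by (simp add: g_def Y_def matrix_transpose_mul matrix_mul_assoc)
      then show ?thesis
        by (simp add: frobenius_inner N_def diag_def if_distrib if_distribR cong: if_cong)
    qed
    have "(real (w i) - real (w j)) * 2 * Y $ i $ j = 0"
    proof (rule linear_term_zero_of_quadratic_bound[of _ "(real (w i) - real (w j)) * (Y $ i $ i - Y $ j $ j)"])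
      fix t :: real
      \<comment> \<open>The rotation angle has tangent $t$; scaling the optimality condition by
        $q^2$ clears the denominators.\<close>
      define q where "q = sqrt (1 + t\<^sup>2)"
      have q: "q\<^sup>2 = 1 + t\<^sup>2" "q > 0" by (simp_all add: q_def add_pos_nonneg)
      define c where "c = 1 / q"
      define s where "s = t / q"
      have cs: "c\<^sup>2 + s\<^sup>2 = 1" using q(2)
        by (simp add: c_def s_def power_divide flip: add_divide_distrib q(1))
      define R where "R = givens_rotation i j c s"
      have "orthogonal_matrix (P ** R)"
        unfolding R_def by (intro orthogonal_matrix_mul P(1) orthogonal_givens_rotation that cs)
      then have "g (P ** R) \<le> g (P ** mat 1)" using P(2) by simp
      then have le: "N \<bullet> (transpose R ** Y ** R) \<le> N \<bullet> Y" by (simp only: g_eq) simp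
      have "N \<bullet> (transpose R ** Y ** R) = (R ** N ** transpose R) \<bullet> Y"
        by (simp add: inner_matrix_mult_right[of "R ** N"] inner_matrix_mult_left[of R] matrix_mul_assoc)
      also have "R ** N ** transpose R = N + (real (w i) - real (w j)) *\<^sub>R
          (s\<^sup>2 *\<^sub>R (matrix_unit j j - matrix_unit i i) + (c * s) *\<^sub>R (matrix_unit i j + matrix_unit j i))"
        unfolding R_def N_def by (rule givens_rotation_conjugate_diagonal[OF that cs])
      also have "\<dots> \<bullet> Y = N \<bullet> Y + (real (w i) - real (w j))
          * (s\<^sup>2 * (Y $ j $ j - Y $ i $ i) + (c * s) * (Y $ i $ j + Y $ j $ i))"
        by (simp add: inner_add_left inner_diff_left inner_matrix_unit inner_commute[of "matrix_unit _ _"])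
      also have "Y $ i $ j + Y $ j $ i = 2 * Y $ i $ j" using Yji by simp
      finally have "(real (w i) - real (w j)) * (s\<^sup>2 * (Y $ j $ j - Y $ i $ i) + (c * s) * (2 * Y $ i $ j)) \<le> 0"
        using le by linarith
      then have "q\<^sup>2 * ((real (w i) - real (w j)) * (s\<^sup>2 * (Y $ j $ j - Y $ i $ i) + (c * s) * (2 * Y $ i $ j))) \<le> 0"
        using q(2) by (simp add: mult_le_0_iff)
      moreover have "q\<^sup>2 * s\<^sup>2 = t\<^sup>2" "q\<^sup>2 * (c * s) = t"
        using q(2) by (simp_all add: s_def c_def power2_eq_square)
      moreover have "q\<^sup>2 * ((real (w i) - real (w j)) * (s\<^sup>2 * (Y $ j $ j - Y $ i $ i) + (c * s) * (2 * Y $ i $ j)))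
          = (real (w i) - real (w j)) * ((q\<^sup>2 * s\<^sup>2) * (Y $ j $ j - Y $ i $ i) + (q\<^sup>2 * (c * s)) * (2 * Y $ i $ j))"
        by (simp add: algebra_simps)
      ultimately show "t * ((real (w i) - real (w j)) * 2 * Y $ i $ j) \<le> t\<^sup>2 * ((real (w i) - real (w j)) * (Y $ i $ i - Y $ j $ j))"
        by (simp add: algebra_simps)
    qed
    moreover have "real (w i) \<noteq> real (w j)" using that w by (simp add: inj_eq)
    ultimately show ?thesis by simp
  qed
  then have "Y = diag (\<lambda>i. Y $ i $ i)" by (auto simp: diag_def vec_eq_iff)
  moreover have "M = P ** Y ** transpose P"
  proof -
    have "P ** Y ** transpose P = (P ** transpose P) ** M ** (P ** transpose P)"
      by (simp add: Y_def matrix_mul_assoc)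
    then show ?thesis using P(1) by (simp add: orthogonal_matrix_def)
  qed
  ultimately show ?thesis by (intro that[OF P(1), of "\<lambda>i. Y $ i $ i"]) simp
qed

section \<open>Eigenvalues and singular values\<close>

lemma norm_mat_1: "(norm (mat 1 :: real ^ 'n ^ 'n))\<^sup>2 = real CARD('n)"
  by (simp add: power2_norm_eq_inner frobenius_inner mat_def if_distrib if_distribR cong: if_cong)

text \<open>The squared Frobenius norm of $Q$ counts both the rows and the columns.\<close>
lemma orthogonal_matrix2_card_eq:
  fixes Q :: "real ^ 'm ^ 'n"
  assumes "orthogonal_matrix2 Q"
  shows "CARD('m) = CARD('n)"
proof -
  have "Q \<bullet> Q = (mat 1 :: real ^ 'm ^ 'm) \<bullet> mat 1"
    using assms inner_matrix_mult_left[of Q "mat 1" Q] by (simp add: orthogonal_matrix2_def)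
  moreover have "Q \<bullet> Q = (mat 1 :: real ^ 'n ^ 'n) \<bullet> mat 1"
    using assms inner_matrix_mult_right[of "mat 1" Q Q] by (simp add: orthogonal_matrix2_def)
  ultimately have "real CARD('m) = real CARD('n)"
    by (metis norm_mat_1 power2_norm_eq_inner)
  then show ?thesis by simp
qed

text \<open>The factorization is lifted to matrices of polynomials, where $Q$ becomes a matrix of constants and
the diagonal factor becomes $x - d_i$; then the determinant is multiplicative.\<close>
lemma charpoly_orthogonal_diag:
  fixes Q :: "real ^ 'n ^ 'n"
  assumes "Q ** transpose Q = mat 1"
  shows "charpoly (Q ** diag d ** transpose Q) = (\<Prod>i\<in>UNIV. [:- d i, 1:])"
proof -
  define Qp :: "real poly ^ 'n ^ 'n" where "Qp = (\<chi> i j. [:Q $ i $ j:])"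
  define L :: "real poly ^ 'n ^ 'n" where "L = (\<chi> i j. if i = j then [:- d i, 1:] else 0)"
  have const_sum: "(\<Sum>k\<in>UNIV. [:f k:]) = [:\<Sum>k\<in>UNIV. f k:]" for f :: "'n \<Rightarrow> real"
    by (simp add: poly_eq_iff coeff_sum coeff_pCons split: nat.splits)
  have QQ: "(\<Sum>k\<in>UNIV. Q $ i $ k * Q $ j $ k) = (if i = j then 1 else 0)" for i j
    using arg_cong[OF assms, of "\<lambda>M. M $ i $ j"]
    by (simp add: matrix_matrix_mult_def transpose_def mat_def)
  have one: "Qp ** transpose Qp = mat 1"
    by (simp add: Qp_def matrix_matrix_mult_def transpose_def mat_def vec_eq_iff const_sum QQ)
  have QDQ: "(Q ** diag d ** transpose Q) $ i $ j = (\<Sum>k\<in>UNIV. d k * (Q $ i $ k * Q $ j $ k))" for i j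
    by (simp add: matrix_matrix_mult_def transpose_def diag_def if_distrib if_distribR mult_ac cong: if_cong)
  have "(Qp ** L ** transpose Qp) $ i $ j
      = (if i = j then [:0, 1:] else 0) - [:(Q ** diag d ** transpose Q) $ i $ j:]" for i j
  proof -
    have "(Qp ** L ** transpose Qp) $ i $ j = (\<Sum>k\<in>UNIV. [:- d k, 1:] * [:Q $ i $ k * Q $ j $ k:])"
      by (simp add: matrix_matrix_mult_def transpose_def L_def Qp_def if_distrib if_distribR mult_ac cong: if_cong)
    also have "\<dots> = (\<Sum>k\<in>UNIV. [:0, 1:] * [:Q $ i $ k * Q $ j $ k:] - [:d k * (Q $ i $ k * Q $ j $ k):])"
      by (intro sum.cong refl) (simp add: mult_ac)
    also have "\<dots> = [:0, 1:] * [:if i = j then 1 else 0:] - [:(Q ** diag d ** transpose Q) $ i $ j:]"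
      by (simp only: sum_subtractf flip: sum_distrib_left) (simp only: const_sum QQ QDQ)
    finally show ?thesis by simp
  qed
  then have "charpoly (Q ** diag d ** transpose Q) = det (Qp ** L ** transpose Qp)"
    unfolding charpoly_def by (intro arg_cong[of _ _ det]) (simp add: vec_eq_iff)
  also have "\<dots> = det L * det (Qp ** transpose Qp)"
    by (simp add: det_mul mult_ac)
  also have "\<dots> = det L" by (simp add: one)
  also have "\<dots> = (\<Prod>i\<in>UNIV. [:- d i, 1:])"
    by (subst det_diagonal) (simp_all add: L_def)
  finally show ?thesis .
qed

text \<open>The index types of rows and columns may differ here, because block decompositions have a sum type as
column index. The columns are relabelled by a bijection to obtain a square matrix.\<close>
lemma eigenvalues_orthogonal_diag:
  fixes Q :: "real ^ 'm ^ 'n"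
  assumes Q: "orthogonal_matrix2 Q"
  shows "eigenvalues (Q ** diag d ** transpose Q) = image_mset d (mset_set UNIV)"
proof -
  obtain \<pi> :: "'n \<Rightarrow> 'm" where \<pi>: "bij \<pi>"
    using finite_same_card_bij[of "UNIV :: 'n set" "UNIV :: 'm set"] orthogonal_matrix2_card_eq[OF Q] by auto
  define P where "P = (\<chi> i j. Q $ i $ \<pi> j)"
  have re: "(\<Sum>k\<in>UNIV. f (\<pi> k)) = (\<Sum>k\<in>UNIV. f k)" for f :: "'m \<Rightarrow> real"
    using sum.reindex_bij_betw[OF \<pi>] .
  have "P ** transpose P = Q ** transpose Q"
    by (simp add: P_def matrix_matrix_mult_def transpose_def vec_eq_iff re[of "\<lambda>k. Q $ _ $ k * Q $ _ $ k"])
  then have P: "P ** transpose P = mat 1" using Q by (simp add: orthogonal_matrix2_def)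
  have "Q ** diag d ** transpose Q = P ** diag (d \<circ> \<pi>) ** transpose P"
    by (simp add: P_def matrix_matrix_mult_def transpose_def diag_def vec_eq_iff if_distrib if_distribR
        re[of "\<lambda>k. Q $ _ $ k * d k * Q $ _ $ k"] cong: if_cong)
  then have "eigenvalues (Q ** diag d ** transpose Q) = proots (\<Prod>i\<in>UNIV. [:- d (\<pi> i), 1:])"
    using charpoly_orthogonal_diag[OF P, of "d \<circ> \<pi>"] by (simp add: eigenvalues_def)
  also have "\<dots> = (\<Sum>i\<in>UNIV. {#d (\<pi> i)#})"
    by (subst proots_prod) simp_all
  also have "\<dots> = image_mset (d \<circ> \<pi>) (mset_set UNIV)"
    by (simp add: sum_unfold_sum_mset comp_def)
  also have "\<dots> = image_mset d (mset_set (range \<pi>))"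
    using \<pi> by (simp add: image_mset_mset_set[symmetric] multiset.map_comp bij_is_inj)
  finally show ?thesis using \<pi> by (simp add: bij_is_surj)
qed

lemma singular_values_orthogonal_diag:
  fixes Q :: "real ^ 'm ^ 'n"
  assumes Q: "orthogonal_matrix2 Q"
  shows "singular_values (Q ** diag d ** transpose Q) = image_mset (\<lambda>i. \<bar>d i\<bar>) (mset_set UNIV)"
proof -
  have "transpose (Q ** diag d ** transpose Q) ** (Q ** diag d ** transpose Q)
      = Q ** diag d ** (transpose Q ** Q) ** diag d ** transpose Q"
    by (simp add: matrix_transpose_mul matrix_mul_assoc)
  also have "\<dots> = Q ** (diag d ** diag d) ** transpose Q"
    using Q by (simp add: orthogonal_matrix2_def matrix_mul_assoc)
  finally show ?thesis
    by (simp add: singular_values_def diag_mult eigenvalues_orthogonal_diag[OF Q] multiset.map_comp comp_def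
        flip: power2_eq_square)
qed

lemma orthogonal_imp_orthogonal2: "orthogonal_matrix P \<Longrightarrow> orthogonal_matrix2 P"
  by (simp add: orthogonal_matrix_def orthogonal_matrix2_def)

text \<open>The trace is the sum of the eigenvalues and the nuclear norm is the sum of their absolute values.\<close>
lemma trace_le_nuclear_norm:
  fixes M :: "real ^ 'n ^ 'n"
  assumes "symmetric_matrix M"
  shows "trace M \<le> nuclear_norm M"
proof -
  obtain P d where P: "orthogonal_matrix P" and M: "M = P ** diag d ** transpose P"
    using spectral_theorem[OF assms] .
  have "trace M = trace (transpose P ** (P ** diag d))"
    unfolding M by (rule trace_mul_sym)
  also have "\<dots> = (\<Sum>i\<in>UNIV. d i)"
    using P by (simp add: matrix_mul_assoc orthogonal_matrix_def trace_def diag_def)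
  also have "\<dots> \<le> (\<Sum>i\<in>UNIV. \<bar>d i\<bar>)" by (intro sum_mono) simp
  also have "\<dots> = nuclear_norm M"
    unfolding M nuclear_norm_def singular_values_orthogonal_diag[OF orthogonal_imp_orthogonal2[OF P]]
    by (simp add: sum_unfold_sum_mset)
  finally show ?thesis .
qed

lemma size_filter_less_le_if_nth_sorted_ge:
  fixes M :: "'a::linorder multiset"
  assumes "v \<le> sorted_list_of_multiset M ! k"
  shows "size (filter_mset (\<lambda>x. x < v) M) \<le> k"
proof -
  define xs where "xs = sorted_list_of_multiset M"
  have M: "M = mset (take k xs) + mset (drop k xs)"
    by (metis append_take_drop_id mset_append mset_sorted_list_of_multiset xs_def)
  have "sorted xs" by (simp add: xs_def)
  have "v \<le> x" if "x \<in> set (drop k xs)" for x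
  proof -
    obtain i where "i < length xs - k" "x = xs ! (k + i)"
      using \<open>x \<in> set (drop k xs)\<close> by (auto simp: in_set_conv_nth)
    then have "xs ! k \<le> x" using \<open>sorted xs\<close> by (simp add: sorted_nth_mono)
    then show ?thesis using assms by (simp add: xs_def)
  qed
  then have "filter_mset (\<lambda>x. x < v) (mset (drop k xs)) = {#}"
    by (auto simp: not_less)
  then have "filter_mset (\<lambda>x. x < v) M = filter_mset (\<lambda>x. x < v) (mset (take k xs))"
    by (subst M) (simp only: filter_union_mset add_0_right)
  then show ?thesis
    using size_filter_mset_lesseq[of "\<lambda>x. x < v" "mset (take k xs)"] by simp
qed

text \<open>These two counts turn statements about a sorted list of eigenvalues into cardinality arguments on
the multiset.\<close>
lemma size_filter_greater_le_nth_largest: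
  fixes M :: "'a::linorder multiset"
  assumes "k < size M"
  shows "size (filter_mset (\<lambda>x. x > rev (sorted_list_of_multiset M) ! k) M) \<le> k"
    and "size (filter_mset (\<lambda>x. x \<ge> rev (sorted_list_of_multiset M) ! k) M) > k"
proof -
  define xs where "xs = rev (sorted_list_of_multiset M)"
  have M: "M = mset (take m xs) + mset (drop m xs)" for m
    by (metis append_take_drop_id mset_append mset_rev mset_sorted_list_of_multiset xs_def)
  have len: "length xs = size M"
    by (metis length_rev mset_sorted_list_of_multiset size_mset xs_def)
  have dec: "xs ! j \<le> xs ! i" if "i \<le> j" "j < length xs" for i j
    using that by (simp add: sorted_rev_nth_mono xs_def)
  have "filter_mset (\<lambda>x. x > xs ! k) (mset (drop k xs)) = {#}"
    by (auto simp: not_less in_set_conv_nth intro!: dec)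
  then have "filter_mset (\<lambda>x. x > xs ! k) M = filter_mset (\<lambda>x. x > xs ! k) (mset (take k xs))"
    by (subst M[of k]) (simp only: filter_union_mset add_0_right)
  then have "size (filter_mset (\<lambda>x. x > xs ! k) M) \<le> k"
    using size_filter_mset_lesseq[of "\<lambda>x. x > xs ! k" "mset (take k xs)"] by simp
  then show "size (filter_mset (\<lambda>x. x > rev (sorted_list_of_multiset M) ! k) M) \<le> k"
    by (simp add: xs_def)
  have "filter_mset (\<lambda>x. x \<ge> xs ! k) (mset (take (Suc k) xs)) = mset (take (Suc k) xs)"
    using assms len by (auto simp: filter_mset_eq_conv in_set_conv_nth less_Suc_eq_le intro!: dec)
  then have "size (filter_mset (\<lambda>x. x \<ge> xs ! k) M) \<ge> length (take (Suc k) xs)"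
    by (subst M[of "Suc k"]) (simp only: filter_union_mset size_union size_mset le_add1)
  then show "size (filter_mset (\<lambda>x. x \<ge> rev (sorted_list_of_multiset M) ! k) M) > k"
    using assms len by (simp add: xs_def)
qed

lemma size_filter_image_mset_UNIV:
  "size (filter_mset p (image_mset d (mset_set (UNIV :: 'a::finite set)))) = card {x. p (d x)}"
  by (simp add: filter_mset_image_mset)

section \<open>Orthogonal splittings of the space\<close>

lemma sum_over_sum_type: "(\<Sum>x\<in>(UNIV :: ('a::finite + 'b::finite) set). f x) = (\<Sum>a\<in>UNIV. f (Inl a)) + (\<Sum>b\<in>UNIV. f (Inr b))"
  using sum.Plus[of "UNIV :: 'a set" "UNIV :: 'b set" f] by (simp add: comp_def)

lemma orthogonal_matrix2_hcat:
  "orthogonal_matrix2 (hcat P Q) \<longleftrightarrow>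
     transpose P ** P = mat 1 \<and> transpose Q ** Q = mat 1 \<and> transpose P ** Q = 0 \<and> transpose Q ** P = 0
     \<and> P ** transpose P + Q ** transpose Q = mat 1"
proof -
  have "transpose (hcat P Q) ** hcat P Q = mat 1 \<longleftrightarrow>
     transpose P ** P = mat 1 \<and> transpose Q ** Q = mat 1 \<and> transpose P ** Q = 0 \<and> transpose Q ** P = 0"
    by (auto simp: vec_eq_iff split_sum_all hcat_def matrix_matrix_mult_def transpose_def mat_def)
  moreover have "hcat P Q ** transpose (hcat P Q) = P ** transpose P + Q ** transpose Q"
    by (simp add: vec_eq_iff hcat_def matrix_matrix_mult_def transpose_def sum_over_sum_type)
  ultimately show ?thesis by (simp add: orthogonal_matrix2_def)
qed

lemma hcat_diag:
  "hcat P Q ** diag (case_sum d e) ** transpose (hcat P Q)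
    = P ** diag d ** transpose P + Q ** diag e ** transpose Q"
  by (simp add: vec_eq_iff matrix_matrix_mult_def[of "_ ** diag _"] matrix_mult_diag_nth transpose_def
      sum_over_sum_type hcat_def)

lemma norm_orthogonal_split:
  fixes M :: "real ^ 'r ^ 'n"
  assumes "orthogonal_matrix2 (hcat P Q)"
  shows "(norm M)\<^sup>2 = (norm (transpose P ** M))\<^sup>2 + (norm (transpose Q ** M))\<^sup>2"
proof -
  have "(norm M)\<^sup>2 = ((P ** transpose P + Q ** transpose Q) ** M) \<bullet> M"
    using assms by (simp add: orthogonal_matrix2_hcat power2_norm_eq_inner)
  then show ?thesis
    by (simp add: matrix_add_rdistrib inner_add_left power2_norm_eq_inner inner_matrix_mult_left
        flip: matrix_mul_assoc)
qed

text \<open>The spectrum of $X$ consists of the $\<sigma>_a$ and of zeros. As the $\<sigma>_a$ are positive,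
they fill the first places of the decreasing list, one for each column of $P$.\<close>
lemma nth_largest_eigenvalue_bounds:
  fixes P :: "real ^ 's ^ 'n" and Q :: "real ^ 't ^ 'n"
  assumes orth: "orthogonal_matrix2 (hcat P Q)" and pos: "\<And>a. 0 < \<sigma> a"
  defines "X \<equiv> P ** diag \<sigma> ** transpose P"
  shows "\<sigma> a \<le> nth_largest_eigenvalue 1 X"
    and "nth_largest_eigenvalue CARD('s) X \<le> \<sigma> a"
    and "0 < nth_largest_eigenvalue CARD('s) X"
proof -
  define d where "d = case_sum \<sigma> (\<lambda>_ :: 't. 0 :: real)"
  have X: "X = hcat P Q ** diag d ** transpose (hcat P Q)"
    unfolding X_def d_def hcat_diag by (simp add: diag_def flip: zero_vec_def)
  define E where "E = eigenvalues X"
  have E: "E = image_mset d (mset_set UNIV)"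
    unfolding E_def X by (rule eigenvalues_orthogonal_diag[OF orth])
  have size: "size E = CARD('s) + CARD('t)" by (simp add: E)
  have filt: "size (filter_mset p E) = card {x. p (d x)}" for p
    unfolding E by (rule size_filter_image_mset_UNIV)
  have ev: "nth_largest_eigenvalue i X = rev (sorted_list_of_multiset E) ! (i - 1)" for i
    by (simp add: nth_largest_eigenvalue_def E_def)
  have "card {x. d x > nth_largest_eigenvalue 1 X} \<le> 0"
    using size_filter_greater_le_nth_largest(1)[of 0 E] size by (simp add: ev filt)
  then have "Inl a \<notin> {x. d x > nth_largest_eigenvalue 1 X}" by auto
  then show "\<sigma> a \<le> nth_largest_eigenvalue 1 X" by (simp add: d_def not_less)
  define v where "v = nth_largest_eigenvalue CARD('s) X"
  have idx: "CARD('s) - 1 < size E" using size by (simp add: less_imp_diff_less)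
  have s0: "CARD('s) > 0" by simp
  have gt: "card {x. d x > v} \<le> CARD('s) - 1" and ge: "card {x. d x \<ge> v} > CARD('s) - 1"
    using size_filter_greater_le_nth_largest[OF idx] by (simp_all add: v_def ev filt)
  have cl: "card (range (Inl :: 's \<Rightarrow> 's + 't)) = CARD('s)" by (simp add: card_image)
  show v0: "0 < v"
  proof (rule ccontr)
    assume "\<not> 0 < v"
    then have "v < \<sigma> x" for x using pos[of x] by linarith
    then have "range Inl \<subseteq> {x. d x > v}" by (auto simp: d_def)
    then have "CARD('s) \<le> card {x. d x > v}" using card_mono[of _ "range Inl"] cl by (metis finite)
    then show False using gt s0 by linarith
  qed
  show "v \<le> \<sigma> a"
  proof (rule ccontr)
    assume "\<not> v \<le> \<sigma> a"
    have "{x. d x \<ge> v} \<subseteq> range Inl - {Inl a}"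
    proof
      fix x assume "x \<in> {x. d x \<ge> v}"
      then show "x \<in> range Inl - {Inl a}"
        using v0 \<open>\<not> v \<le> \<sigma> a\<close> by (cases x) (auto simp: d_def)
    qed
    then have "card {x. d x \<ge> v} \<le> card (range (Inl :: 's \<Rightarrow> 's + 't) - {Inl a})" by (intro card_mono) auto
    also have "\<dots> = CARD('s) - 1" using cl by (simp add: card_Diff_singleton)
    finally show False using ge by simp
  qed
qed

section \<open>The dual certificate outside the range\<close>

text \<open>Complementarity forces $Z P = 0$, so $Z = Q Y Q^T$ and the singular values of $Z$ are one zero for
every column of $P$, together with the eigenvalues of $Y$. At most that many singular values lie
below $\<mu>$, and the zeros already account for all of them; hence $Y$ is at least $\<mu>$ times
the identity.\<close>
lemma dual_certificate_bound:
  fixes P :: "real ^ 's ^ 'n" and Q :: "real ^ 't ^ 'n"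
  assumes orth: "orthogonal_matrix2 (hcat P Q)" and pos: "\<And>a. 0 < \<sigma> a"
    and Z: "psd Z" "Z \<bullet> (P ** diag \<sigma> ** transpose P) = 0"
    and \<mu>: "\<mu> \<le> nth_smallest_singular_value (CARD('s) + 1) Z" "0 < \<mu>"
  shows "\<mu> * (norm (transpose Q ** U))\<^sup>2 \<le> Z \<bullet> (U ** transpose U)"
proof -
  note o = orth[unfolded orthogonal_matrix2_hcat]
  have ZP: "Z ** P = 0"
  proof -
    \<comment> \<open>A square root of the primal solution turns complementarity into a vanishing
      sum of nonnegative quadratic forms.\<close>
    define R where "R = P ** diag (\<lambda>a. sqrt (\<sigma> a))"
    have "R ** transpose R = P ** (diag (\<lambda>a. sqrt (\<sigma> a)) ** diag (\<lambda>a. sqrt (\<sigma> a))) ** transpose P"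
      by (simp add: R_def matrix_transpose_mul matrix_mul_assoc)
    also have "\<dots> = P ** diag \<sigma> ** transpose P"
      using pos by (simp add: diag_mult less_imp_le)
    finally have "(\<Sum>a\<in>UNIV. column a R \<bullet> (Z *v column a R)) = 0"
      using Z(2) by (simp flip: inner_mult_transpose_eq_sum)
    then have "column a R \<bullet> (Z *v column a R) = 0" for a
      using Z(1) by (subst (asm) sum_nonneg_eq_0_iff) (auto simp: psd_def)
    then have "Z *v column a R = 0" for a using psd_kernel[OF Z(1)] by blast
    moreover have "(Z ** R) $ i $ a = (Z *v column a R) $ i" for i a
      by (simp add: matrix_matrix_mult_def matrix_vector_mult_def column_def)
    ultimately have "Z ** R = 0" by (simp add: vec_eq_iff)
    moreover have "(Z ** P) $ i $ a * sqrt (\<sigma> a) = (Z ** R) $ i $ a" for i a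
      by (simp add: R_def matrix_mul_assoc matrix_mult_diag_nth)
    ultimately show ?thesis using pos by (simp add: vec_eq_iff less_imp_neq[symmetric])
  qed
  have symZ: "transpose Z = Z" using Z(1) by (simp add: psd_def symmetric_matrix_def)
  have PZ: "transpose P ** Z = 0"
    using arg_cong[OF ZP, of transpose] by (simp add: matrix_transpose_mul symZ) (simp add: transpose_def vec_eq_iff)
  define Y where "Y = transpose Q ** Z ** Q"
  have psdY: "psd Y" unfolding Y_def by (rule psd_congruence[OF Z(1)])
  have ZY: "Z = Q ** Y ** transpose Q"
  proof -
    have "Z = (P ** transpose P + Q ** transpose Q) ** Z ** (P ** transpose P + Q ** transpose Q)"
      using o by simp
    also have "\<dots> = Q ** (transpose Q ** Z) ** (P ** transpose P + Q ** transpose Q)"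
      by (simp add: matrix_add_rdistrib PZ flip: matrix_mul_assoc)
    also have "\<dots> = Q ** transpose Q ** ((Z ** P) ** transpose P + (Z ** Q) ** transpose Q)"
      by (simp add: matrix_add_ldistrib matrix_mul_assoc)
    finally show ?thesis by (simp add: ZP Y_def matrix_mul_assoc)
  qed
  obtain R e where R: "orthogonal_matrix R" and Y: "Y = R ** diag e ** transpose R"
    using spectral_theorem[of Y] psdY by (auto simp: psd_def)
  have RR: "transpose R ** R = mat 1" "R ** transpose R = mat 1"
    using R by (simp_all add: orthogonal_matrix_def)
  have "transpose R ** Y ** R = (transpose R ** R) ** diag e ** (transpose R ** R)"
    by (simp add: Y matrix_mul_assoc)
  then have e0: "0 \<le> e b" for b
    using psd_congruence[OF psdY, of R] by (simp add: RR psd_diag_iff)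
  have orthR: "orthogonal_matrix2 (hcat P (Q ** R))"
  proof -
    have "transpose (Q ** R) ** (Q ** R) = transpose R ** (transpose Q ** Q) ** R"
      "(Q ** R) ** transpose (Q ** R) = Q ** (R ** transpose R) ** transpose Q"
      "transpose P ** (Q ** R) = (transpose P ** Q) ** R"
      "transpose (Q ** R) ** P = transpose R ** (transpose Q ** P)"
      by (simp_all add: matrix_transpose_mul matrix_mul_assoc)
    then show ?thesis unfolding orthogonal_matrix2_hcat using o RR by simp
  qed
  define f where "f = case_sum (\<lambda>_ :: 's. 0) e"
  have "Z = hcat P (Q ** R) ** diag f ** transpose (hcat P (Q ** R))"
    unfolding f_def hcat_diag
    by (simp add: ZY Y matrix_transpose_mul matrix_mul_assoc) (simp add: diag_def flip: zero_vec_def)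
  then have sv: "singular_values Z = image_mset (\<lambda>x. \<bar>f x\<bar>) (mset_set UNIV)"
    using singular_values_orthogonal_diag[OF orthR] by simp
  have card: "card {x. \<bar>f x\<bar> < \<mu>} \<le> CARD('s)"
    using size_filter_less_le_if_nth_sorted_ge[of \<mu> "singular_values Z" "CARD('s)"] \<mu>(1)
    unfolding nth_smallest_singular_value_def
    by (simp add: sv size_filter_image_mset_UNIV[of "\<lambda>x. x < \<mu>" "\<lambda>x. \<bar>f x\<bar>"])
  have e\<mu>: "\<mu> \<le> e b" for b
  proof (rule ccontr)
    assume "\<not> \<mu> \<le> e b"
    then have "insert (Inr b) (range Inl) \<subseteq> {x. \<bar>f x\<bar> < \<mu>}"
      using e0[of b] \<mu>(2) by (auto simp: f_def)
    then have "card (insert (Inr b) (range (Inl :: 's \<Rightarrow> 's + 't))) \<le> card {x. \<bar>f x\<bar> < \<mu>}"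
      by (intro card_mono) auto
    moreover have "card (insert (Inr b) (range (Inl :: 's \<Rightarrow> 's + 't))) = Suc CARD('s)"
      by (subst card_insert_disjoint) (auto simp: card_image)
    ultimately show False using card by simp
  qed
  have "Y - \<mu> *\<^sub>R mat 1 = transpose (transpose R) ** diag (\<lambda>b. e b - \<mu>) ** transpose R"
  proof -
    have "diag (\<lambda>b. e b - \<mu>) = diag e - \<mu> *\<^sub>R mat 1"
      by (simp add: diag_def mat_def vec_eq_iff)
    then show ?thesis
      by (simp add: Y matrix_diff_ldistrib matrix_diff_rdistrib matrix_scalar_ac RR flip: scalar_matrix_assoc)
  qed
  then have "psd (Y - \<mu> *\<^sub>R mat 1)"
    using e\<mu> by (metis psd_congruence psd_diag_iff diff_ge_0_iff_ge)
  then have "0 \<le> (Y - \<mu> *\<^sub>R mat 1) \<bullet> ((transpose Q ** U) ** transpose (transpose Q ** U))"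
    by (rule psd_inner_mult_transpose_nonneg)
  also have "\<dots> = Y \<bullet> ((transpose Q ** U) ** transpose (transpose Q ** U)) - \<mu> * (norm (transpose Q ** U))\<^sup>2"
    by (simp add: inner_diff_left power2_norm_eq_inner inner_commute[of "mat 1"]
        inner_matrix_mult_right[of _ "transpose (transpose Q ** U)"])
  also have "Y \<bullet> ((transpose Q ** U) ** transpose (transpose Q ** U)) = Z \<bullet> (U ** transpose U)"
    unfolding ZY inner_two_sided_mult by (simp add: matrix_transpose_mul matrix_mul_assoc)
  finally show ?thesis by simp
qed

section \<open>The distance to the orbit\<close>

text \<open>Positive semidefiniteness of $G^T V$ gives $V = T G$ with $T$ positive semidefinite. With $K = T -
I$ and $M = V - G = K G$ the Gram defect is $D = M M^T + M G^T + G M^T$. The last two terms have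
inner product $\|M\|^2$ with $K$, and the first one is bounded below by $-\|M\|^2$ because $K \<ge>
-I$; hence $\|M\|^2 \<le> \langle D, K \rangle \<le> \|D\| \|K\|$. Finally $l \|K\|^2 \<le> \|M\|^2$
removes $K$.\<close>
lemma procrustes_bound:
  fixes G V :: "real ^ 'r ^ 's"
  assumes GG: "G ** transpose G = diag \<sigma>" and \<sigma>: "\<And>a. l \<le> \<sigma> a" and l: "0 < l"
    and psd: "psd (transpose G ** V)"
  shows "l * (norm (V - G))\<^sup>2 \<le> (norm (V ** transpose V - G ** transpose G))\<^sup>2"
proof -
  define S where "S = diag \<sigma>"
  define S' where "S' = diag (\<lambda>a. 1 / \<sigma> a)"
  have \<sigma>0: "\<sigma> a \<noteq> 0" for a using \<sigma>[of a] l by auto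
  have SS: "S' ** S = mat 1" "S ** S' = mat 1"
    using \<sigma>0 by (simp_all add: S_def S'_def diag_mult) (simp_all add: diag_def mat_def)
  have GGS: "G ** transpose G = S" using GG by (simp add: S_def)
  have sym: "transpose V ** G = transpose G ** V"
    using psd by (simp add: psd_def symmetric_matrix_def matrix_transpose_mul)
  \<comment> \<open>A symmetric $T$ with $V = T G$ must satisfy $T S = V G^T$, which leaves only
    this choice.\<close>
  define T where "T = S' ** G ** transpose V"
  have VTG: "V = T ** G"
  proof -
    have "T ** G = S' ** (G ** (transpose V ** G))" by (simp add: T_def matrix_mul_assoc)
    also have "\<dots> = S' ** (G ** transpose G) ** V" by (simp add: sym matrix_mul_assoc)
    finally show ?thesis by (simp add: GGS SS)
  qed
  have T': "T = V ** transpose G ** S'"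
  proof -
    have "T = T ** (S ** S')" by (simp add: SS)
    also have "\<dots> = (T ** G) ** transpose G ** S'" by (simp add: GGS[symmetric] matrix_mul_assoc)
    finally show ?thesis by (simp add: VTG[symmetric])
  qed
  have symT: "transpose T = T"
    by (subst (2) T') (simp add: T_def matrix_transpose_mul matrix_mul_assoc S'_def)
  have psdT: "psd T"
    unfolding psd_def symmetric_matrix_def
  proof (intro conjI allI symT)
    fix v
    define w where "w = transpose G *v (S' *v v)"
    have v: "v = G *v w"
      by (simp only: w_def matrix_vector_mul_assoc matrix_mul_assoc) (simp add: GGS SS)
    have "v \<bullet> (T *v v) = (G *v w) \<bullet> (V *v w)"
      by (simp add: v VTG matrix_vector_mul_assoc)
    also have "\<dots> = w \<bullet> ((transpose G ** V) *v w)"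
      by (simp only: flip: matrix_vector_mul_assoc inner_transpose_matrix_vector)
    finally show "0 \<le> v \<bullet> (T *v v)" using psd by (simp add: psd_def)
  qed
  define K where "K = T - mat 1"
  have symK: "transpose K = K" by (simp add: K_def transpose_diff symT)
  define M where "M = V - G"
  have M: "M = K ** G" by (simp add: M_def K_def VTG matrix_diff_rdistrib)
  define D where "D = V ** transpose V - G ** transpose G"
  have D: "D = M ** transpose M + M ** transpose G + G ** transpose M"
    by (simp add: D_def M_def matrix_distribs)
  have h1: "(M ** transpose G) \<bullet> K = (norm M)\<^sup>2"
    by (simp add: inner_matrix_mult_right power2_norm_eq_inner flip: M)
  have h2: "(G ** transpose M) \<bullet> K = (norm M)\<^sup>2"
    using h1 inner_transpose[of "M ** transpose G" K] by (simp add: matrix_transpose_mul symK)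
  have h3: "(M ** transpose M) \<bullet> mat 1 = (norm M)\<^sup>2"
    by (simp add: inner_matrix_mult_right power2_norm_eq_inner)
  have "(M ** transpose M) \<bullet> K \<ge> - (norm M)\<^sup>2"
    using psd_inner_mult_transpose_nonneg[OF psdT, of M]
    by (simp add: K_def inner_diff_right h3 inner_commute[of T])
  then have "(norm M)\<^sup>2 \<le> D \<bullet> K" by (simp add: D inner_add_left h1 h2)
  also have "\<dots> \<le> norm D * norm K" by (rule norm_cauchy_schwarz)
  finally have DK: "(norm M)\<^sup>2 \<le> norm D * norm K" .
  have "l * (norm K)\<^sup>2 = (\<Sum>i\<in>UNIV. \<Sum>j\<in>UNIV. l * (K $ i $ j)\<^sup>2)"
    by (simp add: power2_norm_matrix sum_distrib_left)
  also have "\<dots> \<le> (\<Sum>i\<in>UNIV. \<Sum>j\<in>UNIV. \<sigma> j * (K $ i $ j)\<^sup>2)"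
    by (intro sum_mono mult_right_mono \<sigma>) simp
  also have "\<dots> = (K ** S) \<bullet> K"
    by (simp add: frobenius_inner S_def matrix_mult_diag_nth power2_eq_square mult_ac)
  also have "K ** S = M ** transpose G"
    by (simp add: M GGS flip: matrix_mul_assoc)
  finally have lK: "l * (norm K)\<^sup>2 \<le> (norm M)\<^sup>2" by (simp add: h1)
  have "l * (norm M)\<^sup>2 \<le> (norm D)\<^sup>2"
  proof (cases "norm M = 0")
    case False
    have "(norm M)\<^sup>2 * (l * (norm M)\<^sup>2) = l * ((norm M)\<^sup>2)\<^sup>2" by (simp add: power2_eq_square)
    also have "\<dots> \<le> l * (norm D * norm K)\<^sup>2"
      using l DK by (intro mult_left_mono power_mono) auto
    also have "\<dots> = (norm D)\<^sup>2 * (l * (norm K)\<^sup>2)" by (simp add: power_mult_distrib)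
    also have "\<dots> \<le> (norm D)\<^sup>2 * (norm M)\<^sup>2" by (intro mult_left_mono lK) simp
    finally show ?thesis using False by (simp add: mult.commute)
  qed simp
  then show ?thesis by (simp add: M_def D_def)
qed

lemma orbit_dist_le:
  assumes "orthogonal_matrix \<Omega>"
  shows "orbit_dist U V \<le> norm (U - V ** \<Omega>)"
  unfolding orbit_dist_def using assms
  by (intro cINF_lower bdd_belowI[of _ 0]) (auto simp: orthogonal_matrix)

lemma orbit_dist_nonneg: "0 \<le> orbit_dist U V"
  unfolding orbit_dist_def
  by (intro cINF_greatest) (auto intro!: exI[of _ "mat 1"])

text \<open>Multiplying by an orthogonal matrix on the right only mixes the columns of $V$ and keeps the
component along $Q$ at zero, so aligning the components along $P$ costs nothing outside.\<close>
lemma orbit_dist_le_gram_defect: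
  fixes P :: "real ^ 's ^ 'n" and Q :: "real ^ 't ^ 'n" and U V :: "real ^ 'r ^ 'n"
  assumes orth: "orthogonal_matrix2 (hcat P Q)"
    and gram: "(transpose P ** V) ** transpose (transpose P ** V) = diag \<sigma>"
    and \<sigma>: "\<And>a. l \<le> \<sigma> a" and l: "0 < l" and QV: "transpose Q ** V = 0"
  shows "(orbit_dist U V)\<^sup>2 \<le>
    (norm ((transpose P ** U) ** transpose (transpose P ** U) - diag \<sigma>))\<^sup>2 / l + (norm (transpose Q ** U))\<^sup>2"
proof -
  define G where "G = transpose P ** V"
  obtain \<Omega> where \<Omega>: "orthogonal_matrix \<Omega>" and psd: "psd (transpose (G ** \<Omega>) ** (transpose P ** U))"
    using procrustes_rotation[where G = G and V = "transpose P ** U"] by blast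
  have "(G ** \<Omega>) ** transpose (G ** \<Omega>) = G ** (\<Omega> ** transpose \<Omega>) ** transpose G"
    by (simp add: matrix_transpose_mul matrix_mul_assoc)
  also have "\<dots> = diag \<sigma>" using \<Omega> gram by (simp add: orthogonal_matrix_def G_def)
  finally have gram': "(G ** \<Omega>) ** transpose (G ** \<Omega>) = diag \<sigma>" .
  have "l * (norm (transpose P ** U - G ** \<Omega>))\<^sup>2
      \<le> (norm ((transpose P ** U) ** transpose (transpose P ** U) - diag \<sigma>))\<^sup>2"
    using procrustes_bound[OF gram' \<sigma> l psd] by (simp add: gram')
  then have le: "(norm (transpose P ** U - G ** \<Omega>))\<^sup>2
      \<le> (norm ((transpose P ** U) ** transpose (transpose P ** U) - diag \<sigma>))\<^sup>2 / l"
    using l by (simp add: field_simps)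
  have "(orbit_dist U V)\<^sup>2 \<le> (norm (U - V ** \<Omega>))\<^sup>2"
    by (intro power_mono orbit_dist_le orbit_dist_nonneg \<Omega>)
  also have "\<dots> = (norm (transpose P ** U - G ** \<Omega>))\<^sup>2 + (norm (transpose Q ** U))\<^sup>2"
    by (simp add: norm_orthogonal_split[OF orth] matrix_diff_ldistrib matrix_mul_assoc G_def QV)
  finally show ?thesis using le by simp
qed

section \<open>The Gram defect of a feasible factor\<close>

text \<open>The operator norm of $G$ is at most $\sqrt u$, since $G G^T$ has the diagonal entries $\<sigma>_a$.\<close>
lemma norm_mult_transpose_le:
  fixes G :: "real ^ 'r ^ 's" and V :: "real ^ 'r ^ 't"
  assumes GG: "G ** transpose G = diag \<sigma>" and \<sigma>: "\<And>a. \<sigma> a \<le> u" and u: "0 \<le> u"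
  shows "norm (V ** transpose G) \<le> sqrt u * norm V"
proof -
  define N where "N = V ** transpose G"
  have "(norm (N ** G))\<^sup>2 = (N ** diag \<sigma>) \<bullet> N"
  proof -
    have "(norm (N ** G))\<^sup>2 = (N ** G ** transpose G) \<bullet> N"
      by (simp add: power2_norm_eq_inner inner_matrix_mult_right[of "N ** G" "transpose G"])
    then show ?thesis by (simp add: GG flip: matrix_mul_assoc)
  qed
  also have "\<dots> = (\<Sum>i\<in>UNIV. \<Sum>j\<in>UNIV. \<sigma> j * (N $ i $ j)\<^sup>2)"
    by (simp add: frobenius_inner matrix_mult_diag_nth power2_eq_square mult_ac)
  also have "\<dots> \<le> (\<Sum>i\<in>UNIV. \<Sum>j\<in>UNIV. u * (N $ i $ j)\<^sup>2)"
    by (intro sum_mono mult_right_mono \<sigma>) simp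
  also have "\<dots> = u * (norm N)\<^sup>2"
    by (simp add: power2_norm_matrix sum_distrib_left)
  finally have NG: "norm (N ** G) \<le> sqrt u * norm N"
    using real_le_rsqrt[of "norm (N ** G)" "u * (norm N)\<^sup>2"] by (simp add: real_sqrt_mult)
  have "norm N * norm N = N \<bullet> N"
    by (simp add: power2_norm_eq_inner flip: power2_eq_square)
  also have "\<dots> = V \<bullet> (N ** G)"
    by (simp add: N_def inner_matrix_mult_right[of V])
  also have "\<dots> \<le> norm V * (sqrt u * norm N)"
    using norm_cauchy_schwarz[of V "N ** G"] mult_left_mono[OF NG, of "norm V"] by simp
  finally have "norm N * norm N \<le> (sqrt u * norm V) * norm N" by (simp add: mult_ac)
  then show ?thesis
    by (cases "norm N = 0") (auto simp: N_def u)
qed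

text \<open>The two mixed blocks contribute equally because $A$ is symmetric.\<close>
lemma inner_gram_block_expansion:
  fixes A :: "real ^ 'n ^ 'n" and P :: "real ^ 's ^ 'n" and Q :: "real ^ 't ^ 'n" and U :: "real ^ 'r ^ 'n"
  assumes orth: "orthogonal_matrix2 (hcat P Q)" and sym: "symmetric_matrix A"
  defines "V \<equiv> transpose P ** U" and "W \<equiv> transpose Q ** U"
  shows "A \<bullet> (U ** transpose U) = (transpose P ** A ** P) \<bullet> (V ** transpose V)
    + (2 * ((transpose Q ** A ** P) \<bullet> (W ** transpose V)) + (transpose Q ** A ** Q) \<bullet> (W ** transpose W))"
proof -
  have "U = (P ** transpose P + Q ** transpose Q) ** U"
    using orth by (simp add: orthogonal_matrix2_hcat)
  then have U: "U = P ** V + Q ** W"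
    by (simp add: matrix_add_rdistrib V_def W_def matrix_mul_assoc)
  have conj: "A \<bullet> (B ** N ** transpose R) = (transpose B ** A ** R) \<bullet> N" for B N R
    using inner_two_sided_mult[of B N R A] by (simp add: inner_commute)
  have cross: "(transpose P ** A ** Q) \<bullet> (V ** transpose W) = (transpose Q ** A ** P) \<bullet> (W ** transpose V)"
    using inner_transpose[of "transpose P ** A ** Q" "V ** transpose W"] sym
    by (simp add: matrix_transpose_mul symmetric_matrix_def matrix_mul_assoc)
  have "U ** transpose U = P ** (V ** transpose V) ** transpose P + P ** (V ** transpose W) ** transpose Q
      + Q ** (W ** transpose V) ** transpose P + Q ** (W ** transpose W) ** transpose Q"
    unfolding U by (simp add: matrix_distribs matrix_transpose_mul matrix_mul_assoc)
  then show ?thesis by (simp add: inner_add_right conj cross)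
qed

text \<open>Every term contains a factor $W$; only the product of $W$ with the fixed factor $G$ is of first
order, all others carry a second small factor.\<close>
lemma cross_terms_bound:
  fixes V G :: "real ^ 'r ^ 's" and W :: "real ^ 'r ^ 't"
  assumes gram: "G ** transpose G = diag \<sigma>" and \<sigma>: "\<And>a. \<sigma> a \<le> u" and u: "0 \<le> u"
    and V: "norm (V - G) \<le> \<epsilon>" and W: "norm W \<le> \<epsilon>"
  shows "\<bar>2 * (B \<bullet> (W ** transpose V)) + E \<bullet> (W ** transpose W)\<bar>
    \<le> (2 * norm B * sqrt u + (2 * norm B + norm E) * \<epsilon>) * norm W"
proof -
  have "W ** transpose V = W ** transpose G + W ** transpose (V - G)"
    by (simp add: matrix_distribs)
  then have "norm (W ** transpose V) \<le> norm (W ** transpose G) + norm (W ** transpose (V - G))"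
    by (metis norm_triangle_ineq)
  also have "\<dots> \<le> sqrt u * norm W + norm W * \<epsilon>"
  proof (intro add_mono norm_mult_transpose_le[OF gram \<sigma> u])
    show "norm (W ** transpose (V - G)) \<le> norm W * \<epsilon>"
      using norm_matrix_mult_le[of W "transpose (V - G)"] V mult_left_mono[OF V, of "norm W"]
      by (simp add: norm_transpose)
  qed
  finally have WV: "norm (W ** transpose V) \<le> (sqrt u + \<epsilon>) * norm W" by (simp add: algebra_simps)
  have WW: "norm (W ** transpose W) \<le> \<epsilon> * norm W"
    using norm_matrix_mult_le[of W "transpose W"] mult_right_mono[OF W, of "norm W"]
    by (simp add: norm_transpose)
  have "\<bar>2 * (B \<bullet> (W ** transpose V)) + E \<bullet> (W ** transpose W)\<bar>
      \<le> 2 * \<bar>B \<bullet> (W ** transpose V)\<bar> + \<bar>E \<bullet> (W ** transpose W)\<bar>" by linarith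
  also have "\<dots> \<le> 2 * (norm B * ((sqrt u + \<epsilon>) * norm W)) + norm E * (\<epsilon> * norm W)"
    using Cauchy_Schwarz_ineq2[of B "W ** transpose V"] mult_left_mono[OF WV, of "norm B"]
      Cauchy_Schwarz_ineq2[of E "W ** transpose W"] mult_left_mono[OF WW, of "norm E"] by simp
  also have "\<dots> = (2 * norm B * sqrt u + (2 * norm B + norm E) * \<epsilon>) * norm W"
    by (simp add: algebra_simps)
  finally show ?thesis .
qed

text \<open>The equal constraint values turn the pairing of $P^T A_i P$ with the Gram defect into the remaining
blocks, which are small with $Q^T U$; non-degeneracy converts these pairings into the norm of the
defect.\<close>
lemma gram_defect_bound:
  fixes A :: "'k::finite \<Rightarrow> real ^ 'n ^ 'n"
    and P :: "real ^ 's ^ 'n" and Q :: "real ^ 't ^ 'n" and U V :: "real ^ 'r ^ 'n"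
  assumes orth: "orthogonal_matrix2 (hcat P Q)" and sym: "\<And>i. symmetric_matrix (A i)"
    and gram: "(transpose P ** V) ** transpose (transpose P ** V) = diag \<sigma>"
    and \<sigma>: "\<And>a. \<sigma> a \<le> u" "0 \<le> u" and QV: "transpose Q ** V = 0"
    and same: "\<And>i. A i \<bullet> (U ** transpose U) = A i \<bullet> (V ** transpose V)"
    and nondeg: "\<And>M. symmetric_matrix M \<Longrightarrow>
      \<gamma> * (norm M)\<^sup>2 \<le> (\<Sum>i\<in>UNIV. ((transpose P ** A i ** P) \<bullet> M)\<^sup>2)"
    and near: "norm (U - V) \<le> \<epsilon>"
  shows "\<gamma> * (norm ((transpose P ** U) ** transpose (transpose P ** U) - diag \<sigma>))\<^sup>2
    \<le> (\<Sum>i\<in>UNIV. (2 * norm (transpose Q ** A i ** P) * sqrt u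
          + (2 * norm (transpose Q ** A i ** P) + norm (transpose Q ** A i ** Q)) * \<epsilon>)\<^sup>2)
        * (norm (transpose Q ** U))\<^sup>2"
proof -
  define G V1 W where "G = transpose P ** V" and "V1 = transpose P ** U" and "W = transpose Q ** U"
  define D where "D = V1 ** transpose V1 - diag \<sigma>"
  have symD: "symmetric_matrix D"
    by (simp add: D_def symmetric_matrix_def transpose_diff matrix_transpose_mul)
  have split: "(norm (V1 - G))\<^sup>2 + (norm W)\<^sup>2 = (norm (U - V))\<^sup>2"
    by (simp add: norm_orthogonal_split[OF orth, of "U - V"] matrix_diff_ldistrib QV G_def V1_def W_def)
  have nV: "norm (V1 - G) \<le> \<epsilon>" and nW: "norm W \<le> \<epsilon>"
  proof -
    have "norm (V1 - G) \<le> norm (U - V)" "norm W \<le> norm (U - V)"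
      by (rule power2_le_imp_le; use split in \<open>simp flip: split\<close>)+
    then show "norm (V1 - G) \<le> \<epsilon>" "norm W \<le> \<epsilon>" using near by auto
  qed
  have "((transpose P ** A i ** P) \<bullet> D)\<^sup>2 \<le> ((2 * norm (transpose Q ** A i ** P) * sqrt u
          + (2 * norm (transpose Q ** A i ** P) + norm (transpose Q ** A i ** Q)) * \<epsilon>) * norm W)\<^sup>2" for i
  proof -
    have "A i \<bullet> (V ** transpose V) = (transpose P ** A i ** P) \<bullet> diag \<sigma>"
      using inner_gram_block_expansion[OF orth sym, of i V] by (simp add: QV gram)
    moreover have "A i \<bullet> (U ** transpose U) = (transpose P ** A i ** P) \<bullet> (V1 ** transpose V1)
        + (2 * ((transpose Q ** A i ** P) \<bullet> (W ** transpose V1)) + (transpose Q ** A i ** Q) \<bullet> (W ** transpose W))"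
      unfolding V1_def W_def by (rule inner_gram_block_expansion[OF orth sym])
    ultimately have "\<bar>(transpose P ** A i ** P) \<bullet> D\<bar>
        = \<bar>2 * ((transpose Q ** A i ** P) \<bullet> (W ** transpose V1)) + (transpose Q ** A i ** Q) \<bullet> (W ** transpose W)\<bar>"
      using same[of i] by (simp add: D_def inner_diff_right)
    also have "\<dots> \<le> (2 * norm (transpose Q ** A i ** P) * sqrt u
          + (2 * norm (transpose Q ** A i ** P) + norm (transpose Q ** A i ** Q)) * \<epsilon>) * norm W"
      using cross_terms_bound[OF gram[folded G_def] \<sigma> nV nW] .
    finally show ?thesis by (rule abs_le_square_iff[THEN iffD1, OF order_trans[OF _ abs_ge_self]])
  qed
  then have "(\<Sum>i\<in>UNIV. ((transpose P ** A i ** P) \<bullet> D)\<^sup>2) \<le>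
      (\<Sum>i\<in>UNIV. ((2 * norm (transpose Q ** A i ** P) * sqrt u
          + (2 * norm (transpose Q ** A i ** P) + norm (transpose Q ** A i ** Q)) * \<epsilon>) * norm W)\<^sup>2)"
    by (rule sum_mono)
  also have "\<dots> = (\<Sum>i\<in>UNIV. (2 * norm (transpose Q ** A i ** P) * sqrt u
          + (2 * norm (transpose Q ** A i ** P) + norm (transpose Q ** A i ** Q)) * \<epsilon>)\<^sup>2) * (norm W)\<^sup>2"
    by (simp add: power_mult_distrib sum_distrib_right)
  finally show ?thesis
    using nondeg[OF symD] by (simp add: D_def V1_def W_def)
qed

section \<open>Local error bound and quadratic growth\<close>

text \<open>The bound on the Gram defect depends continuously on the radius, and at radius zero it gives exactly
the constant $4 u s / (l \<gamma>)$ with $s = \sum_i \|Q^T A_i P\|^2$. A strict inequality for $c$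
therefore survives on some ball.\<close>
lemma local_orbit_dist_bound:
  fixes A :: "'k::finite \<Rightarrow> real ^ 'n ^ 'n"
    and P :: "real ^ 's ^ 'n" and Q :: "real ^ 't ^ 'n" and V :: "real ^ 'r ^ 'n"
  assumes orth: "orthogonal_matrix2 (hcat P Q)" and sym: "\<And>i. symmetric_matrix (A i)"
    and gram: "(transpose P ** V) ** transpose (transpose P ** V) = diag \<sigma>"
    and l: "\<And>a. l \<le> \<sigma> a" "0 < l" and u: "\<And>a. \<sigma> a \<le> u" "0 \<le> u"
    and QV: "transpose Q ** V = 0"
    and nondeg: "\<And>M. symmetric_matrix M \<Longrightarrow>
      \<gamma> * (norm M)\<^sup>2 \<le> (\<Sum>i\<in>UNIV. ((transpose P ** A i ** P) \<bullet> M)\<^sup>2)" "0 < \<gamma>"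
    and c: "0 \<le> c" "c * (4 * u / l * ((\<Sum>i\<in>UNIV. (norm (transpose Q ** A i ** P))\<^sup>2) / \<gamma>) + 1) < 1"
  obtains \<epsilon> where "0 < \<epsilon>"
    "\<And>U. norm (U - V) < \<epsilon> \<Longrightarrow> (\<And>i. A i \<bullet> (U ** transpose U) = A i \<bullet> (V ** transpose V)) \<Longrightarrow>
      c * (orbit_dist U V)\<^sup>2 \<le> (norm (transpose Q ** U))\<^sup>2"
proof -
  define h where "h = (\<lambda>\<epsilon>. \<Sum>i\<in>UNIV. (2 * norm (transpose Q ** A i ** P) * sqrt u
          + (2 * norm (transpose Q ** A i ** P) + norm (transpose Q ** A i ** Q)) * \<epsilon>)\<^sup>2)"
  \<comment> \<open>The assertion holds on a ball of radius $\<epsilon>$ as soon as $q(\<epsilon>)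
    \<le> 1$.\<close>
  define q where "q = (\<lambda>\<epsilon>. c * (h \<epsilon> / (\<gamma> * l) + 1))"
  have "h 0 = 4 * u * (\<Sum>i\<in>UNIV. (norm (transpose Q ** A i ** P))\<^sup>2)"
    using u(2) by (simp add: h_def power_mult_distrib sum_distrib_left mult_ac)
  then have q0: "q 0 < 1" using c(2) by (simp add: q_def mult_ac)
  have "isCont q 0" unfolding q_def h_def by (intro continuous_intros) (use l nondeg(2) in auto)
  then have "(q \<longlongrightarrow> q 0) (at_right 0)"
    unfolding isCont_def by (rule tendsto_mono[rotated]) (simp add: at_le)
  then have "eventually (\<lambda>\<epsilon>. q \<epsilon> < 1 \<and> 0 < \<epsilon>) (at_right 0)"
    using q0 by (intro eventually_conj order_tendstoD(2) eventually_at_right_less) auto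
  then obtain \<epsilon> where \<epsilon>: "q \<epsilon> < 1" "0 < \<epsilon>"
    using eventually_happens'[OF trivial_limit_at_right_real] by blast
  show ?thesis
  proof (rule that[OF \<epsilon>(2)])
    fix U assume U: "norm (U - V) < \<epsilon>" and same: "\<And>i. A i \<bullet> (U ** transpose U) = A i \<bullet> (V ** transpose V)"
    define d where "d = (norm ((transpose P ** U) ** transpose (transpose P ** U) - diag \<sigma>))\<^sup>2"
    define w where "w = (norm (transpose Q ** U))\<^sup>2"
    have "\<gamma> * d \<le> h \<epsilon> * w"
      unfolding d_def h_def w_def
      by (rule gram_defect_bound[OF orth sym gram u QV same nondeg(1)]) (use U in auto)
    then have "d / l \<le> h \<epsilon> / (\<gamma> * l) * w" using nondeg(2) l(2) by (simp add: field_simps)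
    moreover have "(orbit_dist U V)\<^sup>2 \<le> d / l + w"
      unfolding d_def w_def by (rule orbit_dist_le_gram_defect[OF orth gram l QV])
    ultimately have "(orbit_dist U V)\<^sup>2 \<le> (h \<epsilon> / (\<gamma> * l) + 1) * w" by (simp add: distrib_right)
    then have "c * (orbit_dist U V)\<^sup>2 \<le> q \<epsilon> * w"
      using mult_left_mono[OF _ c(1)] by (fastforce simp: q_def mult.assoc)
    also have "\<dots> \<le> 1 * w" using \<epsilon>(1) by (intro mult_right_mono) (auto simp: w_def)
    finally show "c * (orbit_dist U V)\<^sup>2 \<le> (norm (transpose Q ** U))\<^sup>2" by (simp add: w_def)
  qed
qed

text \<open>The local bound costs only $\<kappa> + 1$, so it holds with room to spare for $1 / (2 \<kappa> + 1)$
when $\<kappa> > 0$, and for every constant below $1$ when $\<kappa> = 0$.\<close>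
lemma admissible_constant_bounds:
  assumes "0 \<le> \<kappa>" "admissible_constant \<kappa> c"
  shows "0 < c" "c * (\<kappa> + 1) < 1"
proof -
  have "0 < c \<and> c * (\<kappa> + 1) < 1"
  proof (cases "\<kappa> = 0")
    case False
    then have "0 < \<kappa>" "c = 1 / (2 * \<kappa> + 1)" using assms by (auto simp: admissible_constant_def)
    then show ?thesis by (simp add: add_pos_pos)
  qed (use assms(2) in \<open>simp add: admissible_constant_def\<close>)
  then show "0 < c" "c * (\<kappa> + 1) < 1" by auto
qed

theorem lemma6:
  fixes C :: "real ^ 'n ^ 'n"
    and A :: "'k::finite \<Rightarrow> real ^ 'n ^ 'n"
    and b :: "real ^ 'k"
    and X\<^sub>s :: "real ^ 'n ^ 'n"
    and U\<^sub>s :: "real ^ 'r ^ 'n"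
    and Q\<^sub>1 :: "real ^ 's ^ 'n"
    and \<Sigma>\<^sub>x :: "real ^ 's ^ 's"
    and Q\<^sub>2 :: "real ^ 't ^ 'n"
    and y\<^sub>s :: "real ^ 'k"
    and Z\<^sub>s :: "real ^ 'n ^ 'n"
    and \<mu>\<^sub>Z \<gamma>\<^sub>Q \<kappa> :: real
  assumes "symmetric_matrix C"
    and "\<And>i. symmetric_matrix (A i)"
    and "sdp_solution C A b X\<^sub>s"
    and "rank X\<^sub>s = CARD('s)"
    and "CARD('r) \<ge> CARD('s)"
    and "X\<^sub>s = U\<^sub>s ** transpose U\<^sub>s"
    and "X\<^sub>s = Q\<^sub>1 ** \<Sigma>\<^sub>x ** transpose Q\<^sub>1"
    and "transpose Q\<^sub>1 ** Q\<^sub>1 = mat 1"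
    and "diagonal_matrix \<Sigma>\<^sub>x"
    and "pos_def \<Sigma>\<^sub>x"
    and "orthogonal_matrix2 (hcat Q\<^sub>1 Q\<^sub>2)"
    and "dual_optimal_pair C A X\<^sub>s y\<^sub>s Z\<^sub>s"
    and "\<mu>\<^sub>Z > 0"
    and "nth_smallest_singular_value (CARD('s) + 1) Z\<^sub>s \<ge> \<mu>\<^sub>Z"
    and "\<gamma>\<^sub>Q > 0"
    and "\<And>W. symmetric_matrix W \<Longrightarrow>
           (\<Sum>i\<in>UNIV. ((transpose Q\<^sub>1 ** A i ** Q\<^sub>1) \<bullet> W)\<^sup>2) \<ge> \<gamma>\<^sub>Q * (norm W)\<^sup>2"
    and "smooth_submanifold (factor_feasible_set A b :: (real ^ 'r ^ 'n) set)"
    and "\<kappa> = 4 * nth_largest_eigenvalue 1 X\<^sub>s / nth_largest_eigenvalue (CARD('s)) X\<^sub>s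
             * ((\<Sum>i\<in>UNIV. (norm (transpose Q\<^sub>2 ** A i ** Q\<^sub>1))\<^sup>2) / \<gamma>\<^sub>Q)"
  shows "(\<exists>c. admissible_constant \<kappa> c) \<and>
         (\<forall>c. admissible_constant \<kappa> c \<longrightarrow>
            c > 0 \<and>
            (\<exists>N. open N \<and> U\<^sub>s \<in> N \<and>
               (\<forall>U\<in>N. sdp_feasible A b (U ** transpose U) \<longrightarrow>
                  nuclear_norm (transpose Q\<^sub>2 ** (U ** transpose U) ** Q\<^sub>2)
                    \<ge> c * (orbit_dist U U\<^sub>s)\<^sup>2)) \<and>
            local_quadratic_growth (\<lambda>U. C \<bullet> (U ** transpose U)) (factor_feasible_set A b) U\<^sub>s
              (2 * c * \<mu>\<^sub>Z))"
proof -
  note sym = assms(2) and orth = assms(11) and \<gamma> = assms(15)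
  note o = orth[unfolded orthogonal_matrix2_hcat]
  define \<sigma> where "\<sigma> = (\<lambda>a. \<Sigma>\<^sub>x $ a $ a)"
  have \<Sigma>: "\<Sigma>\<^sub>x = diag \<sigma>"
    using assms(9) by (auto simp: diagonal_matrix_def diag_def \<sigma>_def vec_eq_iff)
  have \<sigma>: "0 < \<sigma> a" for a
  proof -
    have "axis a 1 \<bullet> (\<Sigma>\<^sub>x *v axis a 1) = \<sigma> a"
      by (simp add: \<sigma>_def inner_axis' matrix_vector_mul_component inner_axis)
    moreover have "axis a 1 \<noteq> (0 :: real ^ 's)" by (simp add: axis_eq_0_iff)
    ultimately show ?thesis using assms(10) by (metis pos_def_def)
  qed
  have X: "X\<^sub>s = Q\<^sub>1 ** diag \<sigma> ** transpose Q\<^sub>1" using assms(7) \<Sigma> by simp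
  define u l where "u = nth_largest_eigenvalue 1 X\<^sub>s" and "l = nth_largest_eigenvalue CARD('s) X\<^sub>s"
  have ul: "\<sigma> a \<le> u" "l \<le> \<sigma> a" "0 < l" for a
    unfolding u_def l_def X by (rule nth_largest_eigenvalue_bounds[OF orth \<sigma>])+
  have u0: "0 < u" using ul(1)[of undefined] \<sigma>[of undefined] by linarith
  have gram: "(transpose Q\<^sub>1 ** U\<^sub>s) ** transpose (transpose Q\<^sub>1 ** U\<^sub>s) = diag \<sigma>"
  proof -
    have "(transpose Q\<^sub>1 ** U\<^sub>s) ** transpose (transpose Q\<^sub>1 ** U\<^sub>s)
        = (transpose Q\<^sub>1 ** Q\<^sub>1) ** diag \<sigma> ** (transpose Q\<^sub>1 ** Q\<^sub>1)"
      using arg_cong[OF trans[OF assms(6)[symmetric] X], of "\<lambda>M. transpose Q\<^sub>1 ** M ** Q\<^sub>1"]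
      by (simp add: matrix_transpose_mul matrix_mul_assoc)
    then show ?thesis using o by simp
  qed
  have norm_sq: "(norm M)\<^sup>2 = trace (M ** transpose M)" for M :: "real ^ 'r ^ 't"
    by (simp add: trace_eq_inner_mat_1 power2_norm_eq_inner inner_matrix_mult_right)
  have QU: "transpose Q\<^sub>2 ** U\<^sub>s = 0"
  proof -
    have "(transpose Q\<^sub>2 ** U\<^sub>s) ** transpose (transpose Q\<^sub>2 ** U\<^sub>s)
        = (transpose Q\<^sub>2 ** Q\<^sub>1) ** diag \<sigma> ** (transpose Q\<^sub>1 ** Q\<^sub>2)"
      using arg_cong[OF trans[OF assms(6)[symmetric] X], of "\<lambda>M. transpose Q\<^sub>2 ** M ** Q\<^sub>2"]
      by (simp add: matrix_transpose_mul matrix_mul_assoc)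
    then have "(norm (transpose Q\<^sub>2 ** U\<^sub>s))\<^sup>2 = 0"
      using o by (simp add: norm_sq trace_eq_inner_mat_1)
    then show ?thesis by simp
  qed
  define s where "s = (\<Sum>i\<in>UNIV. (norm (transpose Q\<^sub>2 ** A i ** Q\<^sub>1))\<^sup>2)"
  have \<kappa>: "\<kappa> = 4 * u / l * (s / \<gamma>\<^sub>Q)" using assms(18) by (simp add: u_def l_def s_def)
  have "0 \<le> s" by (simp add: s_def sum_nonneg)
  then have \<kappa>0: "0 \<le> \<kappa>" using u0 ul(3) \<gamma> by (simp add: \<kappa>)
  have feas: "A i \<bullet> (U\<^sub>s ** transpose U\<^sub>s) = b $ i" for i
    using assms(3,6) by (auto simp: sdp_solution_def sdp_feasible_def constraint_map_def vec_eq_iff)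
  have nuc: "(norm (transpose Q\<^sub>2 ** U))\<^sup>2 \<le> nuclear_norm (transpose Q\<^sub>2 ** (U ** transpose U) ** Q\<^sub>2)"
    for U :: "real ^ 'r ^ 'n"
  proof -
    have "transpose Q\<^sub>2 ** (U ** transpose U) ** Q\<^sub>2 = (transpose Q\<^sub>2 ** U) ** transpose (transpose Q\<^sub>2 ** U)"
      by (simp add: matrix_transpose_mul matrix_mul_assoc)
    then show ?thesis
      using trace_le_nuclear_norm[of "(transpose Q\<^sub>2 ** U) ** transpose (transpose Q\<^sub>2 ** U)"]
      by (simp add: norm_sq symmetric_matrix_def matrix_transpose_mul)
  qed
  have Z: "psd Z\<^sub>s" "Z\<^sub>s \<bullet> X\<^sub>s = 0" "C = Z\<^sub>s - (\<Sum>i\<in>UNIV. (y\<^sub>s $ i) *\<^sub>R A i)"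
    using assms(12) by (auto simp: dual_optimal_pair_def algebra_simps)
  have growth: "C \<bullet> (U ** transpose U) - C \<bullet> (U\<^sub>s ** transpose U\<^sub>s) \<ge> \<mu>\<^sub>Z * (norm (transpose Q\<^sub>2 ** U))\<^sup>2"
    if "\<And>i. A i \<bullet> (U ** transpose U) = b $ i" for U :: "real ^ 'r ^ 'n"
  proof -
    have "C \<bullet> (U ** transpose U) - C \<bullet> (U\<^sub>s ** transpose U\<^sub>s) = Z\<^sub>s \<bullet> (U ** transpose U)"
      using Z(2) assms(6) by (simp add: Z(3) inner_diff_left inner_sum_left that feas)
    then show ?thesis
      using dual_certificate_bound[OF orth \<sigma> Z(1) Z(2)[unfolded X] assms(14,13), of U] by simp
  qed
  show ?thesis
  proof (intro conjI allI impI)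
    show "\<exists>c. admissible_constant \<kappa> c"
      by (cases "\<kappa> = 0") (auto simp: admissible_constant_def intro: exI[of _ "1 / 2"])
    fix c assume "admissible_constant \<kappa> c"
    note c = admissible_constant_bounds[OF \<kappa>0 this]
    show "c > 0" by (rule c)
    have "c * (4 * u / l * (s / \<gamma>\<^sub>Q) + 1) < 1" using c(2) by (simp add: \<kappa>)
    then obtain \<epsilon> where \<epsilon>: "0 < \<epsilon>"
      "\<And>U. norm (U - U\<^sub>s) < \<epsilon> \<Longrightarrow> (\<And>i. A i \<bullet> (U ** transpose U) = A i \<bullet> (U\<^sub>s ** transpose U\<^sub>s)) \<Longrightarrow>
        c * (orbit_dist U U\<^sub>s)\<^sup>2 \<le> (norm (transpose Q\<^sub>2 ** U))\<^sup>2"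
      using local_orbit_dist_bound[OF orth sym gram ul(2,3) ul(1) less_imp_le[OF u0] QU assms(16) \<gamma>
          less_imp_le[OF c(1)]] unfolding s_def by blast
    have core: "c * (orbit_dist U U\<^sub>s)\<^sup>2 \<le> (norm (transpose Q\<^sub>2 ** U))\<^sup>2"
      if "U \<in> ball U\<^sub>s \<epsilon>" "\<And>i. A i \<bullet> (U ** transpose U) = b $ i" for U
      using that by (intro \<epsilon>(2)) (auto simp: dist_norm norm_minus_commute feas)
    show "\<exists>N. open N \<and> U\<^sub>s \<in> N \<and> (\<forall>U\<in>N. sdp_feasible A b (U ** transpose U) \<longrightarrow>
        nuclear_norm (transpose Q\<^sub>2 ** (U ** transpose U) ** Q\<^sub>2) \<ge> c * (orbit_dist U U\<^sub>s)\<^sup>2)"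
    proof (intro exI[of _ "ball U\<^sub>s \<epsilon>"] conjI ballI impI)
      fix U assume "U \<in> ball U\<^sub>s \<epsilon>" "sdp_feasible A b (U ** transpose U)"
      then have "c * (orbit_dist U U\<^sub>s)\<^sup>2 \<le> (norm (transpose Q\<^sub>2 ** U))\<^sup>2"
        by (intro core) (auto simp: sdp_feasible_def constraint_map_def vec_eq_iff)
      then show "c * (orbit_dist U U\<^sub>s)\<^sup>2 \<le> nuclear_norm (transpose Q\<^sub>2 ** (U ** transpose U) ** Q\<^sub>2)"
        using nuc by (rule order_trans)
    qed (use \<epsilon>(1) in auto)
    show "local_quadratic_growth (\<lambda>U. C \<bullet> (U ** transpose U)) (factor_feasible_set A b) U\<^sub>s (2 * c * \<mu>\<^sub>Z)"
      unfolding local_quadratic_growth_def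
    proof (intro exI[of _ "ball U\<^sub>s \<epsilon>"] conjI ballI)
      fix U assume "U \<in> ball U\<^sub>s \<epsilon> \<inter> factor_feasible_set A b"
      then have U: "U \<in> ball U\<^sub>s \<epsilon>" "\<And>i. A i \<bullet> (U ** transpose U) = b $ i"
        by (auto simp: factor_feasible_set_def constraint_map_def vec_eq_iff)
      have "2 * c * \<mu>\<^sub>Z / 2 * (orbit_dist U U\<^sub>s)\<^sup>2 = \<mu>\<^sub>Z * (c * (orbit_dist U U\<^sub>s)\<^sup>2)" by simp
      also have "\<dots> \<le> \<mu>\<^sub>Z * (norm (transpose Q\<^sub>2 ** U))\<^sup>2"
        using core[OF U] assms(13) by (intro mult_left_mono) auto
      also have "\<dots> \<le> C \<bullet> (U ** transpose U) - C \<bullet> (U\<^sub>s ** transpose U\<^sub>s)" by (rule growth[OF U(2)])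
      finally show "2 * c * \<mu>\<^sub>Z / 2 * (orbit_dist U U\<^sub>s)\<^sup>2 \<le> C \<bullet> (U ** transpose U) - C \<bullet> (U\<^sub>s ** transpose U\<^sub>s)" .
    qed (use \<epsilon>(1) in auto)
  qed
qed

end
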